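(* Let $\boldsymbol v$ be the elastic scattered field, with Fourier–Bessel expansion $$\boldsymbol v(r,\theta)=\sum_{n=-\infty}^{\infty}\Big[\Big(\alpha_{p,n}(r)\hat\phi_{p,n}+\tfrac{\mathrm i n}{r}\beta_{s,n}(r)\hat\phi_{s,n}\Big)\boldsymbol U_n(\theta)+\Big(\tfrac{\mathrm i n}{r}\beta_{p,n}(r)\hat\phi_{p,n}-\alpha_{s,n}(r)\hat\phi_{s,n}\Big)\boldsymbol V_n(\theta)\Big],$$ and let $\boldsymbol v_N$ be its truncation to $|n|\le N$, where $N$ is an integer. There exist positive constants $C_1$ and $C_2$, independent of $N$, such that for every integer $N\ge 4k_s\rho+1$, $$\|\boldsymbol v-\boldsymbol v_N\|^2_{(L^2(\Gamma_\rho))^2}\le C_1\tau_1^{-2N}+C_2N^2\tau_1^{4-2N},\qquad \tau_1=\rho/R .$$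
   Context: Scattering problem. $D\subset\mathbb R^2$ is a bounded simply connected domain with $C^2$ boundary, $\rho>0$, $B_\rho=\{x\in\mathbb R^2:|x|<\rho\}$, $\Gamma_\rho=\partial B_\rho$, $D\subset B_\rho$, and $B_\rho\setminus\overline D$ is connected. The Lamé constants satisfy $\mu>0$, $\lambda+\mu>0$; $\omega>0$; $k_p=\omega/\sqrt{\lambda+2\mu}$, $k_s=\omega/\sqrt\mu$; $\Delta^*\boldsymbol u=\mu\Delta\boldsymbol u+(\lambda+\mu)\nabla\nabla\cdot\boldsymbol u$. Fix a source point $z\in\Gamma_\rho$ and a polarization $\boldsymbol p\in\mathbb S=\{x\in\mathbb R^2:|x|=1\}$. The incident field is $\boldsymbol u^i(x)=\mathbb G(x,z)\boldsymbol p$, with $\mathbb G(x,y)=\frac1\mu\Phi_s(x,y)\mathbb I+\frac1{\omega^2}\nabla_x\nabla_x^\top(\Phi_s(x,y)-\Phi_p(x,y))$, $\Phi_\xi(x,y)=\frac{\mathrm i}{4}H_0^{(1)}(k_\xi|x-y|)$ for $\xi\in\{p,s\}$, and $H_n^{(1)}$ the Hankel function of the first kind of order $n$. The scattered field $\boldsymbol v$ satisfies $\Delta^*\boldsymbol v+\omega^2\boldsymbol v=0$ in $\mathbb R^2\setminus\overline D$, $\boldsymbol u:=\boldsymbol u^i+\boldsymbol v=0$ on $\partial D$, and the Kupradze–Sommerfeld radiation condition $\lim_{r\to\infty}\sqrt r(\partial_r\boldsymbol v_\xi-\mathrm ik_\xi\boldsymbol v_\xi)=0$, $\xi\in\{p,s\}$,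 $r=|x|$, where $\boldsymbol v_p=-k_p^{-2}\,\mathrm{grad}\,\mathrm{div}\,\boldsymbol v$, $\boldsymbol v_s=-k_s^{-2}\,\mathrm{grad}^\perp\mathrm{div}^\perp\boldsymbol v$, $\mathrm{grad}^\perp=(-\partial_2,\partial_1)^\top$, $\mathrm{div}^\perp=(-\partial_2,\partial_1)$. Expansion. Write $\boldsymbol v=\nabla\phi_p+\mathbf{curl}\,\phi_s$ with scalar potentials $\phi_\xi$ satisfying $\Delta\phi_\xi+k_\xi^2\phi_\xi=0$ and the Sommerfeld radiation condition; in polar coordinates $\mathbf{curl}\,w=\frac1r\partial_\theta w\,\boldsymbol e_r-\partial_r w\,\boldsymbol e_\theta$, with $\boldsymbol e_r=(\cos\theta,\sin\theta)^\top$, $\boldsymbol e_\theta=(-\sin\theta,\cos\theta)^\top$. Fix $R>0$ with $B_R=\{|x|<R\}\subset D$, and set $\Gamma_R=\partial B_R$. Standing assumption: the potentials extend to the exterior of $B_R$, with $\phi_p,\phi_s\in L^2(\Gamma_R)$ on $\Gamma_R$, and are represented there by $$\phi_\xi=\sum_{n\in\mathbb Z}\frac{H_n^{(1)}(k_\xi r)}{H_n^{(1)}(k_\xi R)}\hat\phi_{\xi,n}\mathrm e^{\mathrm in\theta},\quad \xi\in\{p,s\},$$ where $\hat\phi_{\xi,n}$ are the Fourier coefficients of $\phi_\xi$ on $\Gamma_R$. Notation: $\boldsymbol U_n(\theta)=\mathrm e^{\mathrm in\theta}\boldsymbol e_r$, $\boldsymbol V_n(\theta)=\mathrm e^{\mathrm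 in\theta}\boldsymbol e_\theta$, $$\alpha_{\xi,n}(r)=\frac{k_\xi H_n^{(1)\prime}(k_\xi r)}{H_n^{(1)}(k_\xi R)},\qquad \beta_{\xi,n}(r)=\frac{H_n^{(1)}(k_\xi r)}{H_n^{(1)}(k_\xi R)}.$$ *)

theory Defs
  imports "HOL-Analysis.Analysis"
begin

text \<open>
  Bessel functions of order \<open>m \<ge> 0\<close> and real argument \<open>x > 0\<close>, by their standard ascending series;
  \<^const>\<open>Digamma\<close> at the positive integers supplies the constants in the series of the second kind.
\<close>

definition bessel_J_nat :: "nat \<Rightarrow> real \<Rightarrow> real" where
  "bessel_J_nat m x = (\<Sum>j. (-1) ^ j / (fact j * fact (m + j)) * (x / 2) ^ (2 * j + m))"

definition bessel_Y_nat :: "nat \<Rightarrow> real \<Rightarrow> real" where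
  "bessel_Y_nat m x =
     2 / pi * ln (x / 2) * bessel_J_nat m x
     - 1 / pi * (\<Sum>j<m. fact (m - 1 - j) / fact j * (x / 2) powi (2 * int j - int m))
     - 1 / pi * (\<Sum>j. (-1) ^ j * (Digamma (real j + 1) + Digamma (real (m + j) + 1))
                       / (fact j * fact (m + j)) * (x / 2) ^ (2 * j + m))"

text \<open>
  Negative integer orders: \<open>J\<close> and \<open>Y\<close>, and hence the Hankel function of the first kind \<open>J + \<i> Y\<close>,
  of order \<open>-m\<close> are \<open>(-1)^m\<close> times those of order \<open>m\<close>.
\<close>

definition hankel1 :: "int \<Rightarrow> real \<Rightarrow> complex" where
  "hankel1 n x =
     (if n \<ge> 0 then 1 else (-1) ^ nat (- n)) *
     (of_real (bessel_J_nat (nat \<bar>n\<bar>) x) + \<i> * of_real (bessel_Y_nat (nat \<bar>n\<bar>) x))"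

definition pd :: "2 \<Rightarrow> (real^2 \<Rightarrow> 'a::real_normed_vector) \<Rightarrow> real^2 \<Rightarrow> 'a" where
  "pd j f x = frechet_derivative f (at x) (axis j 1)"

text \<open>Twice continuously differentiable; only meant for open \<open>S\<close>.\<close>

definition C2_on :: "(real^2) set \<Rightarrow> (real^2 \<Rightarrow> 'a::real_normed_vector) \<Rightarrow> bool" where
  "C2_on S f \<longleftrightarrow>
     (\<forall>x\<in>S. f differentiable (at x)) \<and>
     (\<forall>j. \<forall>x\<in>S. pd j f differentiable (at x)) \<and>
     (\<forall>i j. continuous_on S (pd i (pd j f)))"

definition grad :: "(real^2 \<Rightarrow> complex) \<Rightarrow> real^2 \<Rightarrow> complex^2" where
  "grad f x = (\<chi> i. pd i f x)"

definition dvg :: "(real^2 \<Rightarrow> complex^2) \<Rightarrow> real^2 \<Rightarrow> complex" where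
  "dvg v x = (\<Sum>i\<in>UNIV. pd i (\<lambda>y. v y $ i) x)"

definition grad_perp :: "(real^2 \<Rightarrow> complex) \<Rightarrow> real^2 \<Rightarrow> complex^2" where
  "grad_perp f x = vector [- pd 2 f x, pd 1 f x]"

definition dvg_perp :: "(real^2 \<Rightarrow> complex^2) \<Rightarrow> real^2 \<Rightarrow> complex" where
  "dvg_perp v x = - pd 2 (\<lambda>y. v y $ 1) x + pd 1 (\<lambda>y. v y $ 2) x"

definition laplacian :: "(real^2 \<Rightarrow> 'a::real_normed_vector) \<Rightarrow> real^2 \<Rightarrow> 'a" where
  "laplacian f x = (\<Sum>j\<in>UNIV. pd j (pd j f) x)"

text \<open>
  Cartesian form of the curl of a scalar \<open>w\<close>; in polar coordinates it reads
  \<open>(1/r) \<partial>\<^sub>\<theta>w e\<^sub>r - \<partial>\<^sub>rw e\<^sub>\<theta>\<close>.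
\<close>

definition vcurl :: "(real^2 \<Rightarrow> complex) \<Rightarrow> real^2 \<Rightarrow> complex^2" where
  "vcurl w x = vector [pd 2 w x, - pd 1 w x]"

definition lame_op :: "real \<Rightarrow> real \<Rightarrow> (real^2 \<Rightarrow> complex^2) \<Rightarrow> real^2 \<Rightarrow> complex^2" where
  "lame_op lam mu u x = mu *\<^sub>R laplacian u x + (lam + mu) *\<^sub>R grad (dvg u) x"

definition radial_deriv :: "(real^2 \<Rightarrow> complex) \<Rightarrow> real^2 \<Rightarrow> complex" where
  "radial_deriv f x = frechet_derivative f (at x) (x /\<^sub>R norm x)"

text \<open>The limit along \<^term>\<open>at_infinity\<close> is uniform in the direction of \<open>x\<close>.\<close>

definition sommerfeld :: "real \<Rightarrow> (real^2 \<Rightarrow> complex) \<Rightarrow> bool" where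
  "sommerfeld k f \<longleftrightarrow>
     ((\<lambda>x. of_real (sqrt (norm x)) * (radial_deriv f x - \<i> * of_real k * f x)) \<longlongrightarrow> 0) at_infinity"

definition kp :: "real \<Rightarrow> real \<Rightarrow> real \<Rightarrow> real" where
  "kp lam mu om = om / sqrt (lam + 2 * mu)"

definition ks :: "real \<Rightarrow> real \<Rightarrow> real" where
  "ks mu om = om / sqrt mu"

definition p_part :: "real \<Rightarrow> (real^2 \<Rightarrow> complex^2) \<Rightarrow> real^2 \<Rightarrow> complex^2" where
  "p_part k v x = (- 1 / k\<^sup>2) *\<^sub>R grad (dvg v) x"

definition s_part :: "real \<Rightarrow> (real^2 \<Rightarrow> complex^2) \<Rightarrow> real^2 \<Rightarrow> complex^2" where
  "s_part k v x = (- 1 / k\<^sup>2) *\<^sub>R grad_perp (dvg_perp v) x"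

definition kupradze_sommerfeld :: "real \<Rightarrow> real \<Rightarrow> (real^2 \<Rightarrow> complex^2) \<Rightarrow> bool" where
  "kupradze_sommerfeld k_p k_s v \<longleftrightarrow>
     (\<forall>i. sommerfeld k_p (\<lambda>x. p_part k_p v x $ i)) \<and>
     (\<forall>i. sommerfeld k_s (\<lambda>x. s_part k_s v x $ i))"

definition helmholtz_fund :: "real \<Rightarrow> real^2 \<Rightarrow> real^2 \<Rightarrow> complex" where
  "helmholtz_fund k x y = \<i> / 4 * hankel1 0 (k * norm (x - y))"

definition navier_green :: "real \<Rightarrow> real \<Rightarrow> real \<Rightarrow> real^2 \<Rightarrow> real^2 \<Rightarrow> complex^2^2" where
  "navier_green lam mu om x y =
     (1 / mu) *\<^sub>R (\<chi> i j. if i = j then helmholtz_fund (ks mu om) x y else 0)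
     + (1 / om\<^sup>2) *\<^sub>R (\<chi> i j. pd i (pd j (\<lambda>x'.
         helmholtz_fund (ks mu om) x' y - helmholtz_fund (kp lam mu om) x' y)) x)"

definition incident_field :: "real \<Rightarrow> real \<Rightarrow> real \<Rightarrow> real^2 \<Rightarrow> real^2 \<Rightarrow> real^2 \<Rightarrow> complex^2" where
  "incident_field lam mu om z p x = navier_green lam mu om x z *v (\<chi> i. of_real (p $ i))"

text \<open>Near each boundary point and in suitable orthogonal coordinates, \<open>D\<close> lies above a \<open>C\<^sup>2\<close> graph.\<close>

definition C2_boundary :: "(real^2) set \<Rightarrow> bool" where
  "C2_boundary D \<longleftrightarrow>
     (\<forall>x0\<in>frontier D. \<exists>r>0. \<exists>T :: real^2 \<Rightarrow> real^2. \<exists>g g' g'' :: real \<Rightarrow> real.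
        orthogonal_transformation T \<and>
        (\<forall>t. (g has_real_derivative g' t) (at t)) \<and>
        (\<forall>t. (g' has_real_derivative g'' t) (at t)) \<and>
        continuous_on UNIV g'' \<and>
        D \<inter> ball x0 r = {x \<in> ball x0 r. g (T x $ 1) < T x $ 2})"

definition polar :: "real \<Rightarrow> real \<Rightarrow> real^2" where
  "polar r \<theta> = vector [r * cos \<theta>, r * sin \<theta>]"

text \<open>
  A function on the circle of radius \<open>r\<close> is given as a function of the angle;
  the arc length element is \<open>r d\<theta>\<close>.
\<close>

definition L2_circle :: "(real \<Rightarrow> 'a::euclidean_space) \<Rightarrow> bool" where
  "L2_circle f \<longleftrightarrow>
     set_borel_measurable lebesgue {0..2*pi} f \<and>
     set_integrable lebesgue {0..2*pi} (\<lambda>\<theta>. (norm (f \<theta>))\<^sup>2)"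

definition L2_circle_norm :: "real \<Rightarrow> (real \<Rightarrow> 'a::euclidean_space) \<Rightarrow> real" where
  "L2_circle_norm r f = sqrt (r * (LINT \<theta>:{0..2*pi}|lebesgue. (norm (f \<theta>))\<^sup>2))"

definition fourier_coeff :: "(real \<Rightarrow> complex) \<Rightarrow> int \<Rightarrow> complex" where
  "fourier_coeff f n =
     1 / (2 * of_real pi) * (LINT \<theta>:{0..2*pi}|lebesgue. f \<theta> * cis (- (of_int n * \<theta>)))"

definition e_r :: "real \<Rightarrow> complex^2" where
  "e_r \<theta> = vector [of_real (cos \<theta>), of_real (sin \<theta>)]"

definition e_theta :: "real \<Rightarrow> complex^2" where
  "e_theta \<theta> = vector [of_real (- sin \<theta>), of_real (cos \<theta>)]"

definition U_mode :: "int \<Rightarrow> real \<Rightarrow> complex^2" where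
  "U_mode n \<theta> = cis (of_int n * \<theta>) *s e_r \<theta>"

definition V_mode :: "int \<Rightarrow> real \<Rightarrow> complex^2" where
  "V_mode n \<theta> = cis (of_int n * \<theta>) *s e_theta \<theta>"

definition alpha :: "real \<Rightarrow> real \<Rightarrow> int \<Rightarrow> real \<Rightarrow> complex" where
  "alpha k R n r = of_real k * vector_derivative (hankel1 n) (at (k * r)) / hankel1 n (k * R)"

definition beta :: "real \<Rightarrow> real \<Rightarrow> int \<Rightarrow> real \<Rightarrow> complex" where
  "beta k R n r = hankel1 n (k * r) / hankel1 n (k * R)"

text \<open>Here \<open>a\<close> and \<open>b\<close> are the Fourier coefficients on the circle of radius \<open>R\<close> of the two potentials.\<close>

definition field_trunc ::
  "real \<Rightarrow> real \<Rightarrow> real \<Rightarrow> (int \<Rightarrow> complex) \<Rightarrow> (int \<Rightarrow> complex) \<Rightarrow> int \<Rightarrow> real \<Rightarrow> real \<Rightarrow> complex^2" where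
  "field_trunc k_p k_s R a b N r \<theta> =
     (\<Sum>n\<in>{-N..N}.
        (alpha k_p R n r * a n + \<i> * of_int n / of_real r * beta k_s R n r * b n) *s U_mode n \<theta>
      + (\<i> * of_int n / of_real r * beta k_p R n r * a n - alpha k_s R n r * b n) *s V_mode n \<theta>)"

end

theory Submission
  imports Defs
begin

text \<open>
  The estimate expresses that the \<open>n\<close>-th mode of a radiating potential decays like
  \<open>(R/r)\<^sup>|\<^sup>n\<^sup>|\<close> away from \<open>\<Gamma>\<^sub>R\<close>. The reason is the behaviour of the Hankel functions for large
  order: with \<open>m = |n|\<close>,
  \<open>H\<^sub>n(x) = \<plusminus>(m-1)! (2/x)\<^sup>m E\<^sub>m(x)\<close>,
  where the normalised function \<open>E\<^sub>m\<close> (\<open>hankel_core\<close>) and its derivative are bounded uniformly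
  in \<open>m\<close> on compact subsets of the half line, and \<open>E\<^sub>m(x) \<longlongrightarrow> -\<i>/\<pi>\<close> as \<open>m \<longlongrightarrow> \<infinity>\<close>. In the quotients
  \<open>\<beta>\<^sub>n\<close> and \<open>\<alpha>\<^sub>n = \<beta>\<^sub>n'\<close> the factorials cancel, which leaves
  \<open>|\<beta>\<^sub>n(r)| \<le> K (R/r)\<^sup>m\<close> and \<open>|\<alpha>\<^sub>n(r)| \<le> K (m+1) (R/r)\<^sup>m\<close> (\<open>radial_factor_bounds\<close>).

  Bessel's inequality bounds the Fourier coefficients of the potentials. If \<open>R < \<rho>\<close>, the
  expansions may therefore be differentiated term by term, and the part with \<open>|n| > N\<close> of the
  resulting expansion of \<open>\<nabla>\<phi>\<^sub>p + curl \<phi>\<^sub>s\<close> is at most a multiple of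
  \<open>\<Sum>\<^sub>m\<^sub>>\<^sub>N (m+1) (R/\<rho>)\<^sup>m\<close>, that is, of \<open>N \<tau>\<^sup>-\<^sup>N\<close>, uniformly in the angle. Squaring and integrating
  over the circle gives \<open>N\<^sup>2 \<tau>\<^sup>-\<^sup>2\<^sup>N\<close>, and \<open>\<tau>\<^sup>-\<^sup>2\<^sup>N \<le> \<tau>\<^sup>4\<^sup>-\<^sup>2\<^sup>N\<close>.

  Two borderline configurations have to be covered. First, the closure of \<open>D\<close> may touch
  \<open>\<Gamma>\<^sub>\<rho>\<close>, so that \<open>v\<close> need not be given by the potentials on \<open>\<Gamma>\<^sub>\<rho>\<close> itself. The pointwise
  estimate is therefore proved for \<open>\<rho> < r < \<rho> + 1\<close> with a constant independent of \<open>r\<close>, and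
  carried over to \<open>r = \<rho>\<close> by continuity of \<open>v\<close> (\<open>boundary_truncation_error\<close>). Secondly, if
  \<open>R = \<rho>\<close> there is no decay at all. Then \<open>\<tau> = 1\<close>, and the assertion is that the squared error grows at
  most like \<open>N\<^sup>2\<close>. The field \<open>v\<close> has a fixed finite norm, and the norm of its truncation
  is controlled by orthogonality of the modes and Bessel's inequality
  (\<open>field_trunc_norm_at_R\<close>).
\<close>

section \<open>Exponential generating functions with bounded coefficients\<close>

text \<open>
  Weighting by \<open>1/i!\<close> makes differentiation a shift of the coefficients. The functions with
  coefficients bounded by \<open>M\<close> are thus closed under differentiation, and all of them, along with
  all their derivatives, obey the same bound \<open>M exp |s|\<close>.
\<close>

definition egf :: "(nat \<Rightarrow> real) \<Rightarrow> real \<Rightarrow> real" where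
  "egf c s = (\<Sum>i. c i / fact i * s ^ i)"

lemma exp_norm_sums: "(\<lambda>i. M * (\<bar>s\<bar> ^ i / fact i)) sums (M * exp \<bar>s\<bar> :: real)"
  using exp_converges[of "\<bar>s\<bar>"] by (intro sums_mult) (simp add: divide_inverse mult.commute)

lemma egf_term_bound:
  assumes "\<And>i. \<bar>c i\<bar> \<le> M"
  shows "norm (c i / fact i * s ^ i) \<le> M * (\<bar>s\<bar> ^ i / fact i)"
  using mult_right_mono[OF assms[of i], of "\<bar>s\<bar> ^ i / fact i"]
  by (simp add: abs_mult power_abs)

lemma egf_sums:
  assumes "\<And>i. \<bar>c i\<bar> \<le> M"
  shows "(\<lambda>i. c i / fact i * s ^ i) sums egf c s"
proof -
  have "summable (\<lambda>i. c i / fact i * s ^ i)"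
    by (rule summable_comparison_test'[OF sums_summable[OF exp_norm_sums] egf_term_bound[OF assms]])
  then show ?thesis unfolding egf_def by (rule summable_sums)
qed

lemma egf_abs_le:
  assumes "\<And>i. \<bar>c i\<bar> \<le> M"
  shows "\<bar>egf c s\<bar> \<le> M * exp \<bar>s\<bar>"
proof -
  have "norm (\<Sum>i. c i / fact i * s ^ i) \<le> (\<Sum>i. M * (\<bar>s\<bar> ^ i / fact i))"
    by (rule norm_suminf_le[OF egf_term_bound[OF assms] sums_summable[OF exp_norm_sums]])
  then show ?thesis using sums_unique[OF exp_norm_sums[of M s]] by (simp add: egf_def)
qed

lemma egf_deriv:
  assumes "\<And>i. \<bar>c i\<bar> \<le> M"
  shows "(egf c has_real_derivative egf (\<lambda>i. c (Suc i)) s) (at s)"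
proof -
  have "diffs (\<lambda>i. c i / fact i) = (\<lambda>i. c (Suc i) / fact i)"
    by (simp add: diffs_def fun_eq_iff del: of_nat_Suc)
  then show ?thesis
    using termdiffs_strong_converges_everywhere[of "\<lambda>i. c i / fact i" s, OF sums_summable[OF egf_sums[OF assms]]]
    by (simp add: egf_def[abs_def])
qed

section \<open>Normal form of the Hankel functions\<close>

text \<open>
  The coefficients \<open>J_coeff\<close> and \<open>Y_coeff\<close> arise when the ascending series of order \<open>m\<close> are
  divided by \<open>(m-1)! (x/2)\<^sup>-\<^sup>m\<close> and written as exponential generating functions in \<open>x\<^sup>2/4\<close>. The
  finite sum in \<open>Y\<^sub>m\<close> supplies the indices below \<open>m\<close>, the two infinite series start at index
  \<open>m\<close>. For \<open>m = 0\<close> truncated subtraction turns \<open>(m-1)!\<close> into \<open>1\<close>, and the formulas remain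
  valid.
\<close>

definition J_coeff :: "nat \<Rightarrow> nat \<Rightarrow> real" where
  "J_coeff m i = (if i < m then 0 else (-1) ^ (i - m) / (fact (i - m) * fact (m - 1)))"

definition Y_coeff :: "nat \<Rightarrow> nat \<Rightarrow> real" where
  "Y_coeff m i =
     (if i < m then fact (m - 1 - i) / fact (m - 1)
      else (-1) ^ (i - m) * (Digamma (real (i - m) + 1) + Digamma (real i + 1)) / (fact (i - m) * fact (m - 1)))"

text \<open>
  Common size of all coefficients that stem from the two infinite series; it tends to \<open>0\<close> as the
  order grows.
\<close>

definition coeff_bd :: "nat \<Rightarrow> real" where
  "coeff_bd m = (real m + 4) / fact (m - 1)"

lemma J_coeff_bound: "\<bar>J_coeff m i\<bar> \<le> coeff_bd m"
proof (cases "i < m")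
  case False
  have "1 * 1 \<le> (real m + 4) * (fact (i - m) :: real)"
    by (intro mult_mono fact_ge_1) auto
  then show ?thesis using False by (simp add: J_coeff_def coeff_bd_def abs_mult field_simps)
qed (simp add: J_coeff_def coeff_bd_def)

text \<open>
  At positive integers the digamma function is a harmonic number minus Euler's constant, which
  lies between \<open>0\<close> and \<open>1\<close>.
\<close>

lemma Digamma_abs_le: "\<bar>Digamma (real k + 1)\<bar> \<le> real k + 1"
proof -
  have "Digamma (real k + 1) = harm k - euler_mascheroni"
    using Digamma_of_nat[of k, where 'a = real] by (simp add: add.commute)
  moreover have "harm k \<le> real k"
  proof (induction k)
    case (Suc k)
    have "inverse (real (Suc k)) \<le> 1" by (simp add: field_simps)
    then show ?case using Suc by (simp add: harm_Suc)
  qed (simp add: harm_def)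
  moreover have "harm k \<ge> (0::real)" by (rule harm_nonneg)
  ultimately show ?thesis
    using euler_mascheroni_pos euler_mascheroni_less_13_over_22 by simp
qed

text \<open>
  The growth of the digamma terms, linear in \<open>i\<close>, is absorbed by \<open>(i-m)!\<close>.
\<close>

lemma Y_coeff_tail_bound:
  assumes "i \<ge> m"
  shows "\<bar>Y_coeff m i\<bar> \<le> coeff_bd m"
proof -
  define j where "j = i - m"
  have i: "i = m + j" using assms by (simp add: j_def)
  have f1: "(1::real) \<le> fact j" by (rule fact_ge_1)
  have f2: "real j \<le> fact j"
    by (metis fact_ge_self of_nat_fact of_nat_le_iff)
  have "\<bar>Digamma (real j + 1) + Digamma (real (m + j) + 1)\<bar> \<le> real m * 1 + (2 * real j + 2)"
    using Digamma_abs_le[of j] Digamma_abs_le[of "m + j"] by simp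
  also have "\<dots> \<le> real m * fact j + 4 * fact j"
    by (intro add_mono mult_left_mono f1) (use f1 f2 in linarith)+
  finally have "\<bar>Digamma (real j + 1) + Digamma (real (m + j) + 1)\<bar> \<le> (real m + 4) * fact j"
    by (simp add: algebra_simps)
  then show ?thesis
    by (simp add: i Y_coeff_def coeff_bd_def abs_mult divide_simps)
qed

lemma Y_coeff_head_bound:
  assumes "i < m" "i > 0"
  shows "\<bar>Y_coeff m i\<bar> \<le> 2 / real m"
proof -
  obtain p where m: "m = Suc (Suc p)" using assms by (cases m; cases "m - 1") auto
  have "fact (m - 1 - i) \<le> (fact p :: real)"
    using assms m by (intro fact_mono) auto
  then have "fact (m - 1 - i) / fact (m - 1) \<le> (fact p / fact (m - 1) :: real)"
    by (intro divide_right_mono) auto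
  also have "\<dots> = 1 / (real p + 1)" by (simp add: m add.commute)
  also have "\<dots> \<le> 2 / real m" by (simp add: m field_simps)
  finally show ?thesis using assms by (simp add: Y_coeff_def)
qed

lemma Y_coeff_bound: "\<bar>Y_coeff m i\<bar> \<le> 1 + coeff_bd m"
proof (cases "i < m")
  case True
  have "fact (m - 1 - i) \<le> (fact (m - 1) :: real)" by (intro fact_mono) auto
  then show ?thesis using True by (simp add: Y_coeff_def coeff_bd_def field_simps)
next
  case False
  then show ?thesis using Y_coeff_tail_bound[of m i] by simp
qed

lemma coeff_bd_nonneg: "coeff_bd m \<ge> 0"
  by (simp add: coeff_bd_def)

text \<open>
  Comparison with \<open>2\<^sup>p/p!\<close>, the general term of a convergent exponential series.
\<close>

lemma coeff_bd_tendsto: "coeff_bd \<longlonglongrightarrow> 0"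
proof -
  have "(\<lambda>p. 5 * (inverse (fact p) * 2 ^ p)) \<longlonglongrightarrow> (5 * 0 :: real)"
    using summable_LIMSEQ_zero[OF summable_exp[of "2::real"]] by (intro tendsto_mult tendsto_const)
  then have lim: "(\<lambda>p. 5 * 2 ^ p / fact p) \<longlonglongrightarrow> (0 :: real)"
    by (simp add: field_simps)
  have "\<bar>coeff_bd (Suc p)\<bar> \<le> 5 * 2 ^ p / fact p" for p
  proof -
    have "real p + 5 \<le> 5 * 2 ^ p"
      by (induction p) auto
    then show ?thesis
      by (simp add: coeff_bd_def divide_right_mono)
  qed
  then have "(\<lambda>p. coeff_bd (Suc p)) \<longlonglongrightarrow> 0"
    by (intro Lim_null_comparison[OF always_eventually lim]) simp
  then show ?thesis by (rule LIMSEQ_imp_Suc)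
qed

lemma coeff_bd_bounded: obtains B where "B > 0" "\<And>m. coeff_bd m \<le> B"
proof -
  have "Bseq coeff_bd" using coeff_bd_tendsto convergent_def by (blast intro: convergent_imp_Bseq)
  then obtain B where "B > 0" "\<And>m. norm (coeff_bd m) \<le> B" by (auto simp: Bseq_def)
  then show ?thesis using that coeff_bd_nonneg by auto
qed

text \<open>
  The coefficient of index \<open>0\<close> equals \<open>1\<close>, and all others tend to \<open>0\<close> uniformly in the index.
  So the leading term \<open>-(m-1)!/\<pi> (2/x)\<^sup>m\<close> of \<open>Y\<^sub>m(x)\<close> dominates for large order.
\<close>

lemma egf_Y_tendsto: "(\<lambda>m. egf (Y_coeff m) s) \<longlonglongrightarrow> 1"
proof -
  have "(\<lambda>m. egf (Y_coeff m) s - 1) \<longlonglongrightarrow> 0"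
  proof (rule Lim_null_comparison)
    have "(\<lambda>m. 2 / real m) \<longlonglongrightarrow> 0" by (rule lim_const_over_n)
    then show "(\<lambda>m. (2 / real m + coeff_bd m) * exp \<bar>s\<bar>) \<longlonglongrightarrow> 0"
      using tendsto_mult[OF tendsto_add[OF _ coeff_bd_tendsto] tendsto_const, of _ 0 "exp \<bar>s\<bar>"] by simp
    show "\<forall>\<^sub>F m in sequentially. norm (egf (Y_coeff m) s - 1) \<le> (2 / real m + coeff_bd m) * exp \<bar>s\<bar>"
    proof (rule eventually_mono[OF eventually_ge_at_top[of 2]])
      fix m :: nat assume m: "m \<ge> 2"
      define c where "c = (\<lambda>i. Y_coeff m i - (if i = 0 then 1 else 0))"
      have cb: "\<bar>c i\<bar> \<le> 2 / real m + coeff_bd m" for i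
        using m Y_coeff_head_bound[of i m] Y_coeff_tail_bound[of m i] coeff_bd_nonneg[of m]
        by (cases "i = 0"; cases "i < m") (auto simp: c_def Y_coeff_def intro: add_increasing add_increasing2)
      have "(\<lambda>i. Y_coeff m i / fact i * s ^ i - (if i = 0 then 1 else 0)) sums (egf (Y_coeff m) s - 1)"
        by (intro sums_diff egf_sums[OF Y_coeff_bound] sums_single[of 0 "\<lambda>_. 1", simplified])
      also have "(\<lambda>i. Y_coeff m i / fact i * s ^ i - (if i = 0 then 1 else 0)) = (\<lambda>i. c i / fact i * s ^ i)"
        by (auto simp: c_def fun_eq_iff)
      finally have "egf (Y_coeff m) s - 1 = egf c s"
        using sums_unique by (simp add: egf_def)
      then show "norm (egf (Y_coeff m) s - 1) \<le> (2 / real m + coeff_bd m) * exp \<bar>s\<bar>"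
        using egf_abs_le[of c, OF cb] by simp
    qed
  qed
  then show ?thesis by (simp add: LIM_zero_iff)
qed

lemma power_shift:
  fixes x :: real
  assumes "x > 0"
  shows "(x / 2) ^ (2 * j + m) * (x / 2) ^ m = (x\<^sup>2 / 4) ^ (m + j)"
proof -
  have "x\<^sup>2 / 4 = (x / 2) ^ 2" by (simp add: power_divide)
  then show ?thesis by (simp flip: power_mult power_add add: algebra_simps)
qed

lemma bessel_J_egf:
  assumes "x > 0"
  shows "bessel_J_nat m x = fact (m - 1) / (x / 2) ^ m * egf (J_coeff m) (x\<^sup>2 / 4)"
proof -
  let ?t = "\<lambda>i. J_coeff m i / fact i * (x\<^sup>2 / 4) ^ i"
  have "?t sums egf (J_coeff m) (x\<^sup>2 / 4)" by (rule egf_sums[OF J_coeff_bound])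
  then have "(\<lambda>j. ?t (j + m)) sums (egf (J_coeff m) (x\<^sup>2 / 4) - (\<Sum>i<m. ?t i))"
    by (rule sums_split_initial_segment)
  also have "(\<Sum>i<m. ?t i) = 0" by (simp add: J_coeff_def)
  finally have "(\<lambda>j. fact (m - 1) / (x / 2) ^ m * ?t (j + m)) sums
     (fact (m - 1) / (x / 2) ^ m * egf (J_coeff m) (x\<^sup>2 / 4))"
    by (intro sums_mult) simp
  also have "(\<lambda>j. fact (m - 1) / (x / 2) ^ m * ?t (j + m)) =
      (\<lambda>j. (-1) ^ j / (fact j * fact (m + j)) * (x / 2) ^ (2 * j + m))"
  proof
    fix j
    have "(x\<^sup>2 / 4) ^ (j + m) = (x / 2) ^ (2 * j + m) * (x / 2) ^ m"
      using power_shift[OF assms, of j m] by (simp add: add.commute)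
    then show "fact (m - 1) / (x / 2) ^ m * ?t (j + m) =
      (-1) ^ j / (fact j * fact (m + j)) * (x / 2) ^ (2 * j + m)"
      using assms by (simp add: J_coeff_def add.commute)
  qed
  finally show ?thesis by (simp add: bessel_J_nat_def sums_iff)
qed

lemma bessel_Y_egf:
  assumes "x > 0"
  shows "bessel_Y_nat m x = fact (m - 1) / (x / 2) ^ m *
    (2 / pi * ln (x / 2) * egf (J_coeff m) (x\<^sup>2 / 4) - 1 / pi * egf (Y_coeff m) (x\<^sup>2 / 4))"
proof -
  let ?c = "fact (m - 1) / (x / 2) ^ m"
  let ?t = "\<lambda>i. Y_coeff m i / fact i * (x\<^sup>2 / 4) ^ i"
  let ?A = "\<Sum>j<m. fact (m - 1 - j) / fact j * (x / 2) powi (2 * int j - int m)"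
  have "?t sums egf (Y_coeff m) (x\<^sup>2 / 4)" by (rule egf_sums[OF Y_coeff_bound])
  then have "(\<lambda>j. ?t (j + m)) sums (egf (Y_coeff m) (x\<^sup>2 / 4) - (\<Sum>i<m. ?t i))"
    by (rule sums_split_initial_segment)
  then have "(\<lambda>j. ?c * ?t (j + m)) sums (?c * (egf (Y_coeff m) (x\<^sup>2 / 4) - (\<Sum>i<m. ?t i)))"
    by (intro sums_mult) simp
  also have "(\<lambda>j. ?c * ?t (j + m)) = (\<lambda>j. (-1) ^ j * (Digamma (real j + 1) + Digamma (real (m + j) + 1))
                       / (fact j * fact (m + j)) * (x / 2) ^ (2 * j + m))"
  proof
    fix j
    have "(x\<^sup>2 / 4) ^ (j + m) = (x / 2) ^ (2 * j + m) * (x / 2) ^ m"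
      using power_shift[OF assms, of j m] by (simp add: add.commute)
    then show "?c * ?t (j + m) = (-1) ^ j * (Digamma (real j + 1) + Digamma (real (m + j) + 1))
                       / (fact j * fact (m + j)) * (x / 2) ^ (2 * j + m)"
      using assms by (simp add: Y_coeff_def add.commute)
  qed
  finally have tail: "(\<lambda>j. (-1) ^ j * (Digamma (real j + 1) + Digamma (real (m + j) + 1))
                       / (fact j * fact (m + j)) * (x / 2) ^ (2 * j + m))
      sums (?c * (egf (Y_coeff m) (x\<^sup>2 / 4) - (\<Sum>i<m. ?t i)))" .
  have head: "?c * (\<Sum>i<m. ?t i) = ?A"
    unfolding sum_distrib_left
  proof (rule sum.cong[OF refl])
    fix j assume "j \<in> {..<m}"
    moreover have "(x / 2) powi (2 * int j - int m) = (x\<^sup>2 / 4) ^ j / (x / 2) ^ m"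
    proof -
      have "(x / 2) powi (2 * int j - int m) = (x / 2) powi (int (2 * j)) / (x / 2) powi int m"
        using assms by (subst power_int_diff) auto
      also have "\<dots> = (x\<^sup>2 / 4) ^ j / (x / 2) ^ m"
        by (simp only: power_int_of_nat power_mult) (simp add: power_divide)
      finally show ?thesis .
    qed
    ultimately show "?c * ?t j = fact (m - 1 - j) / fact j * (x / 2) powi (2 * int j - int m)"
      by (simp add: Y_coeff_def)
  qed
  have "(\<Sum>j. (-1) ^ j * (Digamma (real j + 1) + Digamma (real (m + j) + 1))
           / (fact j * fact (m + j)) * (x / 2) ^ (2 * j + m)) = ?c * egf (Y_coeff m) (x\<^sup>2 / 4) - ?A"
    unfolding head[symmetric] right_diff_distrib[symmetric] using tail by (rule sums_unique[symmetric])
  then show ?thesis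
    unfolding bessel_Y_nat_def bessel_J_egf[OF assms] by (simp only:) (simp add: algebra_simps)
qed

text \<open>
  The Hankel function of order \<open>m\<close> divided by \<open>(m-1)! (x/2)\<^sup>-\<^sup>m\<close>.
\<close>

definition hankel_core :: "nat \<Rightarrow> real \<Rightarrow> complex" where
  "hankel_core m x = of_real (egf (J_coeff m) (x\<^sup>2 / 4))
     + \<i> * of_real (2 / pi * ln (x / 2) * egf (J_coeff m) (x\<^sup>2 / 4) - 1 / pi * egf (Y_coeff m) (x\<^sup>2 / 4))"

definition hankel_core_deriv :: "nat \<Rightarrow> real \<Rightarrow> complex" where
  "hankel_core_deriv m x =
     of_real (x / 2 * egf (\<lambda>i. J_coeff m (Suc i)) (x\<^sup>2 / 4))
     + \<i> * of_real (2 / pi * (1 / x * egf (J_coeff m) (x\<^sup>2 / 4)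
                              + ln (x / 2) * (x / 2 * egf (\<lambda>i. J_coeff m (Suc i)) (x\<^sup>2 / 4)))
                    - 1 / pi * (x / 2 * egf (\<lambda>i. Y_coeff m (Suc i)) (x\<^sup>2 / 4)))"

lemma egf_quarter_square_deriv:
  assumes "\<And>i. \<bar>c i\<bar> \<le> M"
  shows "((\<lambda>x. egf c (x\<^sup>2 / 4)) has_real_derivative (x / 2 * egf (\<lambda>i. c (Suc i)) (x\<^sup>2 / 4))) (at x)"
  by (rule DERIV_chain2[OF egf_deriv[OF assms], THEN DERIV_cong])
     (auto intro!: derivative_eq_intros)

lemma hankel_core_has_deriv:
  assumes "x > 0"
  shows "(hankel_core m has_vector_derivative hankel_core_deriv m x) (at x)"
proof -
  note J = egf_quarter_square_deriv[of "J_coeff m", OF J_coeff_bound, of x]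
  note Y = egf_quarter_square_deriv[of "Y_coeff m", OF Y_coeff_bound, of x]
  have "((\<lambda>x. ln (x / 2)) has_real_derivative 1 / x) (at x)"
    using assms by (auto intro!: derivative_eq_intros simp: field_simps)
  note L = DERIV_mult[OF this J]
  have "((\<lambda>x. 2 / pi * ln (x / 2) * egf (J_coeff m) (x\<^sup>2 / 4) - 1 / pi * egf (Y_coeff m) (x\<^sup>2 / 4))
      has_real_derivative (2 / pi * (1 / x * egf (J_coeff m) (x\<^sup>2 / 4)
                              + ln (x / 2) * (x / 2 * egf (\<lambda>i. J_coeff m (Suc i)) (x\<^sup>2 / 4)))
                    - 1 / pi * (x / 2 * egf (\<lambda>i. Y_coeff m (Suc i)) (x\<^sup>2 / 4)))) (at x)"
    using DERIV_diff[OF DERIV_cmult[OF L, of "2 / pi"] DERIV_cmult[OF Y, of "1 / pi"]]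
    by (simp only: mult_ac add_ac)
  then show ?thesis
    unfolding hankel_core_def[abs_def] hankel_core_deriv_def
    by (intro has_vector_derivative_add has_vector_derivative_mult_right has_vector_derivative_of_real J)
qed

lemma hankel_core_deriv_isCont:
  assumes "x > 0"
  shows "isCont (hankel_core_deriv m) x"
proof -
  have "isCont (\<lambda>x. egf (J_coeff m) (x\<^sup>2 / 4)) x"
    by (rule DERIV_isCont[OF egf_quarter_square_deriv[OF J_coeff_bound]])
  moreover have "isCont (\<lambda>x. egf (\<lambda>i. J_coeff m (Suc i)) (x\<^sup>2 / 4)) x"
    by (rule DERIV_isCont[OF egf_quarter_square_deriv[OF J_coeff_bound]])
  moreover have "isCont (\<lambda>x. egf (\<lambda>i. Y_coeff m (Suc i)) (x\<^sup>2 / 4)) x"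
    by (rule DERIV_isCont[OF egf_quarter_square_deriv[OF Y_coeff_bound]])
  ultimately show ?thesis
    using assms unfolding hankel_core_deriv_def[abs_def] by (intro continuous_intros) auto
qed

text \<open>
  Both generating functions are bounded uniformly in the order, and so are their derivatives; the
  logarithm and the factors \<open>x\<close> and \<open>1/x\<close> do not depend on the order.
\<close>

lemma hankel_core_bounds:
  assumes "0 < x1"
  obtains K where "K > 0" "\<And>m x. x1 \<le> x \<Longrightarrow> x \<le> x2 \<Longrightarrow> norm (hankel_core m x) \<le> K"
    "\<And>m x. x1 \<le> x \<Longrightarrow> x \<le> x2 \<Longrightarrow> norm (hankel_core_deriv m x) \<le> K"
proof -
  obtain B where B: "B > 0" "\<And>m. coeff_bd m \<le> B" using coeff_bd_bounded by blast
  (* M bounds all four generating functions, L the logarithm; K adds up the resulting bounds. *)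
  define M where "M = (1 + B) * exp (x2\<^sup>2 / 4)"
  define L where "L = \<bar>ln (x1 / 2)\<bar> + \<bar>ln (x2 / 2)\<bar>"
  define K where "K = M + (2 * (L * M) + M) + x2 / 2 * M + (2 * (1 / x1 * M + L * (x2 / 2 * M)) + x2 / 2 * M)"
  have M: "M > 0" using B by (simp add: M_def)
  have L: "L \<ge> 0" by (simp add: L_def)
  have egfM: "\<bar>egf c (x\<^sup>2 / 4)\<bar> \<le> M" if "x1 \<le> x" "x \<le> x2" "\<And>i. \<bar>c i\<bar> \<le> 1 + B" for c x
  proof -
    have "\<bar>egf c (x\<^sup>2 / 4)\<bar> \<le> (1 + B) * exp \<bar>x\<^sup>2 / 4\<bar>" by (rule egf_abs_le[OF that(3)])
    also have "\<dots> \<le> M" unfolding M_def using that assms B by (intro mult_left_mono) (auto intro: power_mono)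
    finally show ?thesis .
  qed
  have *: "\<bar>J_coeff m i\<bar> \<le> 1 + B" "\<bar>Y_coeff m i\<bar> \<le> 1 + B" for m i
    using J_coeff_bound[of m i] Y_coeff_bound[of m i] B(2)[of m] by auto
  have pi: "1 / pi \<le> 1" "1 / pi \<ge> 0" using pi_ge_two by (auto simp: field_simps)
  have scaled: "\<bar>1 / pi * t\<bar> \<le> u" if "\<bar>t\<bar> \<le> u" for t u
    using mult_mono[OF pi(1) that] pi(2) by (auto simp: abs_mult)
  have prod: "\<bar>s * t\<bar> \<le> a * b" if "\<bar>s\<bar> \<le> a" "\<bar>t\<bar> \<le> b" for s t a b :: real
    unfolding abs_mult using that by (intro mult_mono) auto
  have comb: "\<bar>2 / pi * s - 1 / pi * t\<bar> \<le> 2 * a + b" if "\<bar>s\<bar> \<le> a" "\<bar>t\<bar> \<le> b" for s t a b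
  proof -
    have "2 / pi * s - 1 / pi * t = 2 * (1 / pi * s) - 1 / pi * t" by simp
    then show ?thesis using scaled[OF that(1)] scaled[OF that(2)] by linarith
  qed
  have nrm: "norm (complex_of_real s + \<i> * of_real t) \<le> a + b" if "\<bar>s\<bar> \<le> a" "\<bar>t\<bar> \<le> b" for s t a b
    using norm_triangle_ineq[of "complex_of_real s" "\<i> * of_real t"] that by (simp add: norm_mult)
  have est: "norm (hankel_core m x) \<le> M + (2 * (L * M) + M) \<and>
       norm (hankel_core_deriv m x) \<le> x2 / 2 * M + (2 * (1 / x1 * M + L * (x2 / 2 * M)) + x2 / 2 * M)"
    if x: "x1 \<le> x" "x \<le> x2" for m x
  proof -
    have x0: "x > 0" using x assms by simp
    have l: "\<bar>ln (x / 2)\<bar> \<le> L"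
    proof -
      have "ln (x1 / 2) \<le> ln (x / 2)" "ln (x / 2) \<le> ln (x2 / 2)" using x assms by auto
      then show ?thesis unfolding L_def by linarith
    qed
    have J: "\<bar>egf (J_coeff m) (x\<^sup>2 / 4)\<bar> \<le> M" and Y: "\<bar>egf (Y_coeff m) (x\<^sup>2 / 4)\<bar> \<le> M"
      by (intro egfM x *)+
    have x': "\<bar>x / 2\<bar> \<le> x2 / 2" "\<bar>1 / x\<bar> \<le> 1 / x1" using x assms by (auto simp: frac_le)
    have J': "\<bar>x / 2 * egf (\<lambda>i. J_coeff m (Suc i)) (x\<^sup>2 / 4)\<bar> \<le> x2 / 2 * M"
      and Y': "\<bar>x / 2 * egf (\<lambda>i. Y_coeff m (Suc i)) (x\<^sup>2 / 4)\<bar> \<le> x2 / 2 * M"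
      by (intro prod x' egfM x *)+
    have 1: "\<bar>2 / pi * ln (x / 2) * egf (J_coeff m) (x\<^sup>2 / 4) - 1 / pi * egf (Y_coeff m) (x\<^sup>2 / 4)\<bar> \<le> 2 * (L * M) + M"
      using comb[OF prod[OF l J] Y] by (simp only: mult.assoc)
    have 2: "\<bar>2 / pi * (1 / x * egf (J_coeff m) (x\<^sup>2 / 4) + ln (x / 2) * (x / 2 * egf (\<lambda>i. J_coeff m (Suc i)) (x\<^sup>2 / 4)))
                    - 1 / pi * (x / 2 * egf (\<lambda>i. Y_coeff m (Suc i)) (x\<^sup>2 / 4))\<bar>
       \<le> 2 * (1 / x1 * M + L * (x2 / 2 * M)) + x2 / 2 * M"
      by (intro comb Y' order.trans[OF abs_triangle_ineq add_mono[OF prod[OF x'(2) J] prod[OF l J']]])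
    show ?thesis
      unfolding hankel_core_def hankel_core_deriv_def by (intro conjI nrm J J' 1 2)
  qed
  show ?thesis
  proof (cases "x1 \<le> x2")
    case True
    define p q u w where "p = x2 / 2 * M" and "q = 1 / x1 * M" and "u = L * M" and "w = L * p"
    note abbr = this
    have "p \<ge> 0" "q \<ge> 0" "u \<ge> 0" "w \<ge> 0"
      using True assms M L by (simp_all add: abbr)
    moreover have "K = M + (2 * u + M) + p + (2 * (q + w) + p)"
      by (simp add: K_def abbr)
    ultimately have "K > 0" "M + (2 * u + M) \<le> K" "p + (2 * (q + w) + p) \<le> K"
      using M by simp_all
    then have "K > 0" "M + (2 * (L * M) + M) \<le> K"
      "x2 / 2 * M + (2 * (1 / x1 * M + L * (x2 / 2 * M)) + x2 / 2 * M) \<le> K"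
      unfolding abbr by simp_all
    with est show ?thesis using that by (meson order.trans)
  next
    case False
    then show ?thesis using that[of 1] by auto
  qed
qed

lemma hankel_core_tendsto: "(\<lambda>m. hankel_core m x) \<longlonglongrightarrow> - \<i> / pi"
proof -
  have J: "(\<lambda>m. egf (J_coeff m) (x\<^sup>2 / 4)) \<longlonglongrightarrow> 0"
  proof (rule Lim_null_comparison[OF always_eventually])
    show "\<forall>m. norm (egf (J_coeff m) (x\<^sup>2 / 4)) \<le> coeff_bd m * exp \<bar>x\<^sup>2 / 4\<bar>"
      unfolding real_norm_def by (intro allI egf_abs_le J_coeff_bound)
    show "(\<lambda>m. coeff_bd m * exp \<bar>x\<^sup>2 / 4\<bar>) \<longlonglongrightarrow> 0"
      using tendsto_mult_right[OF coeff_bd_tendsto] by fastforce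
  qed
  have "(\<lambda>m. hankel_core m x) \<longlonglongrightarrow>
     of_real 0 + \<i> * of_real (2 / pi * ln (x / 2) * 0 - 1 / pi * 1)"
    unfolding hankel_core_def by (intro tendsto_intros J egf_Y_tendsto)
  then show ?thesis by simp
qed

text \<open>
  The limit of the normalised functions is not \<open>0\<close>, so their inverses converge. A zero at one of
  finitely many small orders is harmless: since \<open>inverse 0 = 0\<close>, the bound covers it, and the
  quotients \<open>alpha\<close> and \<open>beta\<close> vanish for such an order.
\<close>

lemma inverse_hankel_core_bounded:
  obtains K where "K > 0" "\<And>m. norm (inverse (hankel_core m x)) \<le> K"
proof -
  have "(\<lambda>m. inverse (hankel_core m x)) \<longlonglongrightarrow> inverse (- \<i> / pi)"
    by (intro tendsto_inverse hankel_core_tendsto) simp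
  then have "Bseq (\<lambda>m. inverse (hankel_core m x))"
    by (blast intro: convergent_imp_Bseq convergentI)
  then show ?thesis using that by (auto simp: Bseq_def)
qed

definition hankel_scale :: "int \<Rightarrow> real" where
  "hankel_scale n = (if n \<ge> 0 then 1 else (-1) ^ nat (- n)) * fact (nat \<bar>n\<bar> - 1)"

lemma hankel_scale_nonzero: "hankel_scale n \<noteq> 0"
  by (simp add: hankel_scale_def)

lemma hankel1_core:
  assumes "x > 0"
  shows "hankel1 n x = of_real (hankel_scale n / (x / 2) ^ nat \<bar>n\<bar>) * hankel_core (nat \<bar>n\<bar>) x"
  unfolding hankel1_def bessel_J_egf[OF assms] bessel_Y_egf[OF assms] hankel_scale_def hankel_core_def
  by (simp add: algebra_simps)

lemma inverse_power_deriv: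
  assumes "(x::real) > 0"
  shows "((\<lambda>x. c / (x / 2) ^ m) has_real_derivative (c / (x / 2) ^ m * (- real m / x))) (at x)"
proof -
  have "((\<lambda>x. c / (x / 2) ^ m) has_real_derivative - (c * (real m * (x / 2) ^ (m - 1) * (1/2))) / ((x / 2) ^ m * (x / 2) ^ m)) (at x)"
    using assms by (auto intro!: derivative_eq_intros)
  also have "- (c * (real m * (x / 2) ^ (m - 1) * (1/2))) / ((x / 2) ^ m * (x / 2) ^ m) = c / (x / 2) ^ m * (- real m / x)"
    using assms by (cases m) (auto simp: field_simps)
  finally show ?thesis .
qed

lemma hankel1_has_deriv:
  assumes "x > 0"
  shows "(hankel1 n has_vector_derivative
      of_real (hankel_scale n / (x / 2) ^ nat \<bar>n\<bar>) *
      (hankel_core_deriv (nat \<bar>n\<bar>) x - of_real (real (nat \<bar>n\<bar>) / x) * hankel_core (nat \<bar>n\<bar>) x)) (at x)"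
proof -
  let ?m = "nat \<bar>n\<bar>"
  let ?p = "\<lambda>x. hankel_scale n / (x / 2) ^ ?m"
  have "((\<lambda>x. of_real (?p x) * hankel_core ?m x) has_vector_derivative
     (of_real (?p x) * hankel_core_deriv ?m x + of_real (?p x * (- real ?m / x)) * hankel_core ?m x)) (at x)"
    by (intro has_vector_derivative_mult has_vector_derivative_of_real hankel_core_has_deriv inverse_power_deriv assms)
  then have "(hankel1 n has_vector_derivative
     (of_real (?p x) * hankel_core_deriv ?m x + of_real (?p x * (- real ?m / x)) * hankel_core ?m x)) (at x)"
    by (rule has_vector_derivative_transform_within_open[where S = "{0<..}"]) (use assms hankel1_core in auto)
  then show ?thesis by (simp add: algebra_simps)
qed

section \<open>Decay of the radial factors\<close>

text \<open>
  The factorials and the sign of negative orders cancel in the quotient of two values of the same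
  order. What remains is the geometric factor that governs the decay of the modes.
\<close>

lemma hankel_scale_ratio:
  assumes "k > 0" "R > 0" "r > 0"
  shows "complex_of_real (hankel_scale n / (k * r / 2) ^ m) * inverse (of_real (hankel_scale n / (k * R / 2) ^ m))
    = of_real ((R / r) ^ m)"
proof -
  have "hankel_scale n / (k * r / 2) ^ m * inverse (hankel_scale n / (k * R / 2) ^ m) = (R / r) ^ m"
    using assms hankel_scale_nonzero[of n] by (simp add: power_divide power_mult_distrib field_simps)
  then show ?thesis by (metis of_real_inverse of_real_mult)
qed

lemma beta_core:
  assumes "k > 0" "R > 0" "r > 0"
  shows "beta k R n r = of_real ((R / r) ^ nat \<bar>n\<bar>) * (hankel_core (nat \<bar>n\<bar>) (k * r) * inverse (hankel_core (nat \<bar>n\<bar>) (k * R)))"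
proof -
  have "k * r > 0" "k * R > 0" using assms by simp_all
  then show ?thesis
    unfolding hankel_scale_ratio[OF assms, of n, symmetric]
    by (simp only: beta_def hankel1_core divide_inverse_commute inverse_mult_distrib mult_ac)
qed

lemma alpha_core:
  assumes "k > 0" "R > 0" "r > 0"
  shows "alpha k R n r = of_real ((R / r) ^ nat \<bar>n\<bar>) *
    ((of_real k * hankel_core_deriv (nat \<bar>n\<bar>) (k * r) - of_real (real (nat \<bar>n\<bar>) / r) * hankel_core (nat \<bar>n\<bar>) (k * r))
      * inverse (hankel_core (nat \<bar>n\<bar>) (k * R)))"
proof -
  let ?m = "nat \<bar>n\<bar>"
  have kr: "k * r > 0" "k * R > 0" using assms by simp_all
  have D: "of_real k * (hankel_core_deriv ?m (k * r) - of_real (real ?m / (k * r)) * hankel_core ?m (k * r))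
      = of_real k * hankel_core_deriv ?m (k * r) - of_real (real ?m / r) * hankel_core ?m (k * r)"
    using assms by (simp add: field_simps)
  show ?thesis
    unfolding hankel_scale_ratio[OF assms, of n, symmetric] D[symmetric] alpha_def
      vector_derivative_at[OF hankel1_has_deriv[OF kr(1), of n]] hankel1_core[OF kr(2)]
    by (simp only: divide_inverse_commute inverse_mult_distrib mult_ac)
qed

lemma beta_has_deriv:
  assumes "k > 0" "R > 0" "r > 0"
  shows "(beta k R n has_vector_derivative alpha k R n r) (at r)"
proof -
  have "k * r > 0" using assms by simp
  from hankel1_has_deriv[OF this, of n]
  have "(hankel1 n has_vector_derivative vector_derivative (hankel1 n) (at (k * r))) (at (k * r))"
    by (simp add: vector_derivative_at)
  moreover have "((\<lambda>r. k * r) has_vector_derivative k) (at r)"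
    by (auto intro!: derivative_eq_intros)
  ultimately have "((\<lambda>r. hankel1 n (k * r)) has_vector_derivative k *\<^sub>R vector_derivative (hankel1 n) (at (k * r))) (at r)"
    using vector_diff_chain_at[of "\<lambda>r. k * r" k r "hankel1 n"] by (simp add: o_def)
  from has_vector_derivative_mult_right[OF this, of "inverse (hankel1 n (k * R))"]
  show ?thesis
    unfolding beta_def[abs_def] alpha_def by (simp add: divide_inverse mult.commute scaleR_conv_of_real mult.left_commute)
qed

lemma alpha_isCont:
  assumes "k > 0" "R > 0" "r > 0"
  shows "isCont (alpha k R n) r"
proof -
  let ?m = "nat \<bar>n\<bar>"
  have kr: "k * r > 0" using assms by simp
  have 1: "isCont (\<lambda>r. hankel_core_deriv ?m (k * r)) r"
    by (rule isCont_o2[where f = "\<lambda>r. k * r", OF _ hankel_core_deriv_isCont[OF kr]]) (intro continuous_intros)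
  have 2: "isCont (\<lambda>r. hankel_core ?m (k * r)) r"
    by (rule isCont_o2[where f = "\<lambda>r. k * r", OF _ has_vector_derivative_continuous[OF hankel_core_has_deriv[OF kr]]])
       (intro continuous_intros)
  have "isCont (\<lambda>r. of_real ((R / r) ^ ?m) *
    ((of_real k * hankel_core_deriv ?m (k * r) - of_real (real ?m / r) * hankel_core ?m (k * r))
      * inverse (hankel_core ?m (k * R)))) r"
    using assms by (intro continuous_intros 1 2) auto
  moreover have "\<forall>\<^sub>F s in nhds r. alpha k R n s = of_real ((R / s) ^ ?m) *
    ((of_real k * hankel_core_deriv ?m (k * s) - of_real (real ?m / s) * hankel_core ?m (k * s))
      * inverse (hankel_core ?m (k * R)))"
    using eventually_nhds_in_open[of "{0<..}" r] assms
    by (auto elim!: eventually_mono simp: alpha_core[OF assms(1,2)])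
  ultimately show ?thesis by (subst isCont_cong)
qed

lemma radial_factor_bounds:
  assumes "k > 0" "R > 0" "r1 > 0"
  obtains K where "K > 0"
    "\<And>n r. r1 \<le> r \<Longrightarrow> r \<le> r2 \<Longrightarrow> norm (beta k R n r) \<le> K * (R / r) ^ nat \<bar>n\<bar>"
    "\<And>n r. r1 \<le> r \<Longrightarrow> r \<le> r2 \<Longrightarrow> norm (alpha k R n r) \<le> K * (real (nat \<bar>n\<bar>) + 1) * (R / r) ^ nat \<bar>n\<bar>"
proof -
  obtain B where B: "B > 0"
    "\<And>m x. k * r1 \<le> x \<Longrightarrow> x \<le> k * r2 \<Longrightarrow> norm (hankel_core m x) \<le> B"
    "\<And>m x. k * r1 \<le> x \<Longrightarrow> x \<le> k * r2 \<Longrightarrow> norm (hankel_core_deriv m x) \<le> B"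
    using hankel_core_bounds[of "k * r1" "k * r2"] assms by auto
  obtain I where I: "I > 0" "\<And>m. norm (inverse (hankel_core m (k * R))) \<le> I"
    using inverse_hankel_core_bounded by blast
  define K where "K = (1 + k + 1 / r1) * B * I"
  have B1: "1 * B * I \<le> K" "K > 0"
    unfolding K_def using B(1) I(1) assms by (auto intro!: mult_right_mono mult_pos_pos add_pos_pos)
  show ?thesis
  proof (rule that[OF B1(2)])
    fix n r assume r: "r1 \<le> r" "r \<le> r2"
    let ?m = "nat \<bar>n\<bar>" and ?q = "(R / r) ^ nat \<bar>n\<bar>"
    have r0: "r > 0" using r assms by simp
    then have q: "?q \<ge> 0" using assms by simp
    have core: "norm (hankel_core ?m (k * r)) \<le> B" "norm (hankel_core_deriv ?m (k * r)) \<le> B"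
      using B(2,3) r assms by auto
    have "norm (beta k R n r) = ?q * (norm (hankel_core ?m (k * r)) * norm (inverse (hankel_core ?m (k * R))))"
      using q by (simp only: beta_core[OF assms(1,2) r0] norm_mult norm_of_real abs_of_nonneg)
    also have "\<dots> \<le> ?q * (B * I)"
      using core I B q by (intro mult_left_mono mult_mono) auto
    also have "\<dots> \<le> ?q * K" using B1 q by (intro mult_left_mono) auto
    finally show "norm (beta k R n r) \<le> K * ?q" by (simp add: mult.commute)
    have "norm (of_real k * hankel_core_deriv ?m (k * r) - of_real (real ?m / r) * hankel_core ?m (k * r))
        \<le> k * B + real ?m / r1 * B"
    proof (rule order.trans[OF norm_triangle_ineq4 add_mono])
      show "norm (complex_of_real k * hankel_core_deriv ?m (k * r)) \<le> k * B"
        using assms core by (simp add: norm_mult)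
      have "norm (complex_of_real (real ?m / r) * hankel_core ?m (k * r)) = real ?m / r * norm (hankel_core ?m (k * r))"
        using r0 by (simp add: norm_mult norm_divide)
      also have "\<dots> \<le> real ?m / r1 * B"
        using core r r0 assms B by (intro mult_mono divide_left_mono) auto
      finally show "norm (complex_of_real (real ?m / r) * hankel_core ?m (k * r)) \<le> real ?m / r1 * B" .
    qed
    also have "\<dots> \<le> (1 + k + 1 / r1) * (real ?m + 1) * B"
    proof -
      have "k + real ?m / r1 \<le> (1 + k + 1 / r1) * (real ?m + 1)"
        using assms by (simp add: algebra_simps)
      from mult_right_mono[OF this, of B] show ?thesis using B(1) by (simp add: algebra_simps)
    qed
    finally have D: "norm (of_real k * hankel_core_deriv ?m (k * r) - of_real (real ?m / r) * hankel_core ?m (k * r))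
        \<le> (1 + k + 1 / r1) * (real ?m + 1) * B" .
    have "norm (alpha k R n r) = ?q * (norm (of_real k * hankel_core_deriv ?m (k * r) - of_real (real ?m / r) * hankel_core ?m (k * r)) * norm (inverse (hankel_core ?m (k * R))))"
      unfolding alpha_core[OF assms(1,2) r0] using q by (simp only: norm_mult norm_of_real abs_of_nonneg mult.assoc)
    also have "\<dots> \<le> ?q * ((1 + k + 1 / r1) * (real ?m + 1) * B * I)"
      using I B q assms by (intro mult_left_mono mult_mono D) auto
    finally show "norm (alpha k R n r) \<le> K * (real ?m + 1) * ?q"
      by (simp only: K_def mult_ac)
  qed
qed

section \<open>Termwise differentiation of two-sided expansions\<close>

text \<open>
  Collecting the indices \<open>m\<close> and \<open>-m\<close> turns a two-sided series into an ordinary one whose partial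
  sums are exactly the truncations to \<open>|n| \<le> N\<close>.
\<close>

definition sym_pair :: "(int \<Rightarrow> 'a::real_normed_vector) \<Rightarrow> nat \<Rightarrow> 'a" where
  "sym_pair f m = (if m = 0 then f 0 else f (int m) + f (- int m))"

lemma sum_sym_pair: "(\<Sum>n\<in>{- int N..int N}. f n) = (\<Sum>m\<le>N. sym_pair f m)"
proof (induction N)
  case (Suc N)
  have "{- int (Suc N)..int (Suc N)} = insert (int (Suc N)) (insert (- int (Suc N)) {- int N..int N})"
    by auto
  then show ?case using Suc by (simp add: sym_pair_def add.commute add.left_commute)
qed (simp add: sym_pair_def)

lemma has_sum_imp_sym_pair_sums:
  assumes "(f has_sum s) (UNIV :: int set)"
  shows "sym_pair f sums s"
proof -
  have "filterlim (\<lambda>N. {- int N..int N}) (finite_subsets_at_top UNIV) sequentially"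
    unfolding filterlim_finite_subsets_at_top
  proof safe
    fix X :: "int set" assume X: "finite X"
    then obtain N where N: "\<And>x. x \<in> X \<Longrightarrow> nat \<bar>x\<bar> \<le> N"
      by (metis finite_imageI finite_nat_set_iff_bounded_le imageI)
    show "\<forall>\<^sub>F N in sequentially. finite {- int N..int N} \<and> X \<subseteq> {- int N..int N} \<and> {- int N..int N} \<subseteq> UNIV"
      using eventually_ge_at_top[of N]
    proof eventually_elim
      case (elim n)
      then show ?case using N by force
    qed
  qed
  from filterlim_compose[OF assms[unfolded has_sum_def] this] show ?thesis
    by (simp add: sums_def_le sum_sym_pair)
qed

lemma sym_pair_norm_le:
  assumes "\<And>n. norm (g n) \<le> K * (real (nat \<bar>n\<bar>) + 1) * q ^ nat \<bar>n\<bar>" "K \<ge> 0" "q \<ge> 0"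
  shows "norm (sym_pair g m) \<le> 2 * K * ((real m + 1) * q ^ m)"
proof (cases "m = 0")
  case True
  then show ?thesis using assms(1)[of 0] assms(2) by (simp add: sym_pair_def)
next
  case False
  have "norm (g (int m) + g (- int m)) \<le> K * (real m + 1) * q ^ m + K * (real m + 1) * q ^ m"
    using assms(1)[of "int m"] assms(1)[of "- int m"] by (intro norm_triangle_mono) auto
  then show ?thesis using False by (simp add: sym_pair_def algebra_simps)
qed

lemma weighted_geometric_sums:
  assumes "0 \<le> q" "q < (1::real)"
  shows "(\<lambda>m. (real m + 1) * q ^ m) sums (1 / (1 - q)\<^sup>2)"
  using geometric_deriv_sums[of q] assms by (simp add: add.commute)

text \<open>
  For \<open>N \<ge> 1\<close> the weights satisfy \<open>i + N + 2 \<le> 3 N (i + 1)\<close>, which splits off the factor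
  \<open>N q\<^sup>N\<close> and leaves the convergent series \<open>\<Sum> (i + 1) q\<^sup>i\<close>.
\<close>

lemma sym_pair_tail_bound:
  fixes g :: "int \<Rightarrow> 'a::banach"
  assumes g: "\<And>n. norm (g n) \<le> K * (real (nat \<bar>n\<bar>) + 1) * q ^ nat \<bar>n\<bar>" and K: "K \<ge> 0"
    and q: "0 \<le> q" "q < 1" and N: "N \<ge> 1"
  shows "norm ((\<Sum>m. sym_pair g m) - (\<Sum>n\<in>{- int N..int N}. g n)) \<le> 6 * K / (1 - q)\<^sup>2 * real N * q ^ N"
proof -
  note bd = sym_pair_norm_le[OF g K q(1)]
  have summ: "summable (sym_pair g)"
    by (rule summable_comparison_test'[OF summable_mult[OF sums_summable[OF weighted_geometric_sums[OF q]]] bd])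
  have "(\<Sum>m. sym_pair g m) - (\<Sum>n\<in>{- int N..int N}. g n) = (\<Sum>i. sym_pair g (i + Suc N))"
    using suminf_split_initial_segment[OF summ, of "Suc N"] by (simp add: sum_sym_pair lessThan_Suc_atMost)
  also have "norm \<dots> \<le> (\<Sum>i. 6 * K * real N * q ^ N * ((real i + 1) * q ^ i))"
  proof (rule norm_suminf_le)
    show "summable (\<lambda>i. 6 * K * real N * q ^ N * ((real i + 1) * q ^ i))"
      by (intro summable_mult sums_summable[OF weighted_geometric_sums[OF q]])
    fix i
    have "real (i + Suc N) + 1 \<le> 3 * real N * (real i + 1)"
    proof -
      have "real i * 1 \<le> real i * real N" using N by (intro mult_left_mono) auto
      then show ?thesis using N by (simp add: algebra_simps)
    qed
    moreover have "q ^ (i + Suc N) \<le> q ^ N * q ^ i"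
      using q by (simp add: power_add mult_left_le_one_le mult.commute)
    ultimately have "(real (i + Suc N) + 1) * q ^ (i + Suc N) \<le> 3 * real N * (real i + 1) * (q ^ N * q ^ i)"
      using q by (intro mult_mono) auto
    from mult_left_mono[OF this, of "2 * K"]
    show "norm (sym_pair g (i + Suc N)) \<le> 6 * K * real N * q ^ N * ((real i + 1) * q ^ i)"
      using bd[of "i + Suc N"] K by (simp add: algebra_simps)
  qed
  also have "\<dots> = 6 * K * real N * q ^ N * (1 / (1 - q)\<^sup>2)"
    by (rule sums_unique[symmetric, OF sums_mult[OF weighted_geometric_sums[OF q]]])
  finally show ?thesis by simp
qed

text \<open>
  The geometric bound on the derivatives is uniform on the interval, so the Weierstrass M-test
  yields uniform convergence of the differentiated series.
\<close>

lemma sym_pair_termwise_deriv: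
  fixes f g :: "int \<Rightarrow> real \<Rightarrow> complex"
  assumes deriv: "\<And>n x. a < x \<Longrightarrow> x < b \<Longrightarrow> (f n has_vector_derivative g n x) (at x)"
    and bound: "\<And>n x. a < x \<Longrightarrow> x < b \<Longrightarrow> norm (g n x) \<le> K * (real (nat \<bar>n\<bar>) + 1) * q ^ nat \<bar>n\<bar>"
    and K: "K \<ge> 0" and q: "0 \<le> q" "q < 1"
    and series: "\<And>x. a < x \<Longrightarrow> x < b \<Longrightarrow> sym_pair (\<lambda>n. f n x) sums F x"
    and x: "a < x" "x < b"
  shows "(F has_vector_derivative (\<Sum>m. sym_pair (\<lambda>n. g n x) m)) (at x)"
proof -
  let ?S = "{a<..<b}"
  let ?G = "\<lambda>x. \<Sum>m. sym_pair (\<lambda>n. g n x) m"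
  have unif: "uniform_limit ?S (\<lambda>N x. \<Sum>m<N. sym_pair (\<lambda>n. g n x) m) ?G sequentially"
  proof (rule Weierstrass_m_test)
    show "summable (\<lambda>m. 2 * K * ((real m + 1) * q ^ m))"
      by (intro summable_mult sums_summable[OF weighted_geometric_sums[OF q]])
    show "norm (sym_pair (\<lambda>n. g n x) m) \<le> 2 * K * ((real m + 1) * q ^ m)" if "x \<in> ?S" for m x
      using that bound K q by (intro sym_pair_norm_le) auto
  qed
  have "\<exists>h. \<forall>x\<in>?S. (\<lambda>m. sym_pair (\<lambda>n. f n x) m) sums h x \<and> (h has_derivative (\<lambda>t. t *\<^sub>R ?G x)) (at x within ?S)"
  proof (rule has_derivative_series)
    show "convex ?S" by simp
    show "((\<lambda>x. sym_pair (\<lambda>n. f n x) m) has_derivative (\<lambda>t. t *\<^sub>R sym_pair (\<lambda>n. g n x) m)) (at x within ?S)"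
      if "x \<in> ?S" for m x
    proof -
      have "((\<lambda>x. sym_pair (\<lambda>n. f n x) m) has_vector_derivative sym_pair (\<lambda>n. g n x) m) (at x)"
        using that deriv by (cases "m = 0") (auto simp: sym_pair_def intro: has_vector_derivative_add)
      then show ?thesis
        unfolding has_vector_derivative_def by (rule has_derivative_at_withinI)
    qed
    show "\<forall>\<^sub>F N in sequentially. \<forall>x\<in>?S. \<forall>h. norm ((\<Sum>m<N. h *\<^sub>R sym_pair (\<lambda>n. g n x) m) - h *\<^sub>R ?G x) \<le> e * norm h"
      if "e > 0" for e
      using uniform_limitD[OF unif that]
    proof eventually_elim
      case (elim N)
      show ?case
      proof safe
        fix x h :: real assume "x \<in> ?S"
        then have "norm ((\<Sum>m<N. sym_pair (\<lambda>n. g n x) m) - ?G x) \<le> e"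
          using elim by (auto simp: dist_norm intro: less_imp_le)
        then have "\<bar>h\<bar> * norm ((\<Sum>m<N. sym_pair (\<lambda>n. g n x) m) - ?G x) \<le> \<bar>h\<bar> * e"
          by (rule mult_left_mono) simp
        then show "norm ((\<Sum>m<N. h *\<^sub>R sym_pair (\<lambda>n. g n x) m) - h *\<^sub>R ?G x) \<le> e * norm h"
          by (simp flip: scaleR_right_diff_distrib scaleR_sum_right add: mult.commute)
      qed
    qed
    show "x \<in> ?S" using x by simp
    show "(\<lambda>m. sym_pair (\<lambda>n. f n x) m) sums F x" using series x by blast
  qed
  then obtain h where h: "\<And>x. x \<in> ?S \<Longrightarrow> sym_pair (\<lambda>n. f n x) sums h x"
      "\<And>x. x \<in> ?S \<Longrightarrow> (h has_vector_derivative ?G x) (at x within ?S)"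
    unfolding has_vector_derivative_def by blast
  have "(h has_vector_derivative ?G x) (at x)"
    using h(2)[of x] x at_within_open[of x ?S] by simp
  then show ?thesis
    by (rule has_vector_derivative_transform_within_open[where S = ?S])
       (use x sums_unique2[OF h(1) series] in auto)
qed

section \<open>The field in polar coordinates\<close>

lemma polar_has_radial_deriv: "((\<lambda>r. polar r \<theta>) has_vector_derivative polar 1 \<theta>) (at r within S)"
proof -
  have "(\<lambda>r. polar r \<theta>) = (\<lambda>r. r *\<^sub>R polar 1 \<theta>)"
    by (auto simp: fun_eq_iff polar_def vec_eq_iff forall_2)
  then show ?thesis by (auto intro!: derivative_eq_intros)
qed

lemma polar_has_angular_deriv:
  "((\<lambda>\<theta>. polar r \<theta>) has_vector_derivative r *\<^sub>R vector [- sin \<theta>, cos \<theta>]) (at \<theta> within S)"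
proof -
  have eq: "(\<lambda>\<theta>. polar r \<theta>) = (\<lambda>\<theta>. (r * cos \<theta>) *\<^sub>R axis 1 1 + (r * sin \<theta>) *\<^sub>R axis 2 1)"
    by (auto simp: fun_eq_iff polar_def vec_eq_iff forall_2 axis_def)
  have eq': "r *\<^sub>R (vector [- sin \<theta>, cos \<theta>] :: real^2) = (- (r * sin \<theta>)) *\<^sub>R axis 1 1 + (r * cos \<theta>) *\<^sub>R axis 2 1"
    by (auto simp: vec_eq_iff forall_2 axis_def)
  show ?thesis unfolding eq eq'
    by (auto intro!: derivative_eq_intros simp: mult.commute)
qed

lemma norm_polar [simp]: "norm (polar r \<theta>) = \<bar>r\<bar>"
proof -
  have "(norm (polar r \<theta>))\<^sup>2 = r\<^sup>2"
    by (simp add: norm_vec_def L2_set_def sum_2 polar_def power_mult_distrib flip: distrib_left)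
  then show ?thesis by (metis abs_norm_cancel power2_eq_iff_nonneg abs_ge_zero power2_abs norm_ge_zero)
qed

text \<open>
  The chain rule expresses the two polar derivatives by the Cartesian ones; the rotation by
  \<open>\<theta>\<close> is then inverted.
\<close>

lemma pd_polar:
  fixes f :: "real^2 \<Rightarrow> complex"
  assumes "f differentiable (at (polar r \<theta>))" "r > 0"
    and "((\<lambda>s. f (polar s \<theta>)) has_vector_derivative Dr) (at r)"
    and "((\<lambda>t. f (polar r t)) has_vector_derivative D\<theta>) (at \<theta>)"
  shows "pd 1 f (polar r \<theta>) = of_real (cos \<theta>) * Dr - of_real (sin \<theta>) / of_real r * D\<theta>"
    and "pd 2 f (polar r \<theta>) = of_real (sin \<theta>) * Dr + of_real (cos \<theta>) / of_real r * D\<theta>"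
proof -
  let ?F = "frechet_derivative f (at (polar r \<theta>))"
  have F: "(f has_derivative ?F) (at (polar r \<theta>))"
    using assms(1) by (simp add: frechet_derivative_works)
  have lin: "linear ?F" using F by (rule has_derivative_linear)
  have split: "?F (vector [a, b]) = a *\<^sub>R pd 1 f (polar r \<theta>) + b *\<^sub>R pd 2 f (polar r \<theta>)" for a b
  proof -
    have "(vector [a, b] :: real^2) = a *\<^sub>R axis 1 1 + b *\<^sub>R axis 2 1"
      by (auto simp: vec_eq_iff forall_2 axis_def)
    then show ?thesis by (simp add: linear_add[OF lin] linear_scale[OF lin] pd_def)
  qed
  have "((\<lambda>s. f (polar s \<theta>)) has_vector_derivative ?F (polar 1 \<theta>)) (at r)"
    using vector_derivative_diff_chain_within[OF polar_has_radial_deriv has_derivative_at_withinI[OF F]]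
    by (simp add: o_def)
  then have 1: "Dr = cos \<theta> *\<^sub>R pd 1 f (polar r \<theta>) + sin \<theta> *\<^sub>R pd 2 f (polar r \<theta>)"
    using vector_derivative_unique_at[OF assms(3)] split[of "cos \<theta>" "sin \<theta>"]
    by (simp add: polar_def[of 1])
  have "((\<lambda>t. f (polar r t)) has_vector_derivative ?F (r *\<^sub>R vector [- sin \<theta>, cos \<theta>])) (at \<theta>)"
    using vector_derivative_diff_chain_within[OF polar_has_angular_deriv has_derivative_at_withinI[OF F]]
    by (simp add: o_def)
  then have 2: "D\<theta> = r *\<^sub>R (- sin \<theta> *\<^sub>R pd 1 f (polar r \<theta>) + cos \<theta> *\<^sub>R pd 2 f (polar r \<theta>))"
    using vector_derivative_unique_at[OF assms(4)] by (simp add: linear_scale[OF lin] split)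
  define c d where "c = complex_of_real (cos \<theta>)" and "d = complex_of_real (sin \<theta>)"
  have sc: "c * c + d * d = 1"
    unfolding c_def d_def by (simp only: of_real_mult[symmetric] of_real_add[symmetric] sin_cos_squared_add3 of_real_1)
  have r: "x / of_real r * (of_real r * y) = x * y" for x y :: complex
    using assms(2) by simp
  have "c * (c * P + d * Q) - d * (- d * P + c * Q) = (c * c + d * d) * P"
       "d * (c * P + d * Q) + c * (- d * P + c * Q) = (c * c + d * d) * Q" for P Q
    by (simp_all add: algebra_simps)
  then show "pd 1 f (polar r \<theta>) = of_real (cos \<theta>) * Dr - of_real (sin \<theta>) / of_real r * D\<theta>"
    "pd 2 f (polar r \<theta>) = of_real (sin \<theta>) * Dr + of_real (cos \<theta>) / of_real r * D\<theta>"
    unfolding 1 2 scaleR_conv_of_real r of_real_minus c_def[symmetric] d_def[symmetric] sc by simp_all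
qed

lemma grad_plus_vcurl_polar:
  fixes f g :: "real^2 \<Rightarrow> complex"
  assumes "f differentiable (at (polar r \<theta>))" "g differentiable (at (polar r \<theta>))" "r > 0"
    and "((\<lambda>s. f (polar s \<theta>)) has_vector_derivative fr) (at r)"
    and "((\<lambda>t. f (polar r t)) has_vector_derivative ft) (at \<theta>)"
    and "((\<lambda>s. g (polar s \<theta>)) has_vector_derivative gr) (at r)"
    and "((\<lambda>t. g (polar r t)) has_vector_derivative gt) (at \<theta>)"
  shows "grad f (polar r \<theta>) + vcurl g (polar r \<theta>)
    = (fr + gt / of_real r) *s e_r \<theta> + (ft / of_real r - gr) *s e_theta \<theta>"
  unfolding vec_eq_iff forall_2 grad_def vcurl_def e_r_def e_theta_def
  by (simp add: pd_polar[OF assms(1,3,4,5)] pd_polar[OF assms(2,3,6,7)] algebra_simps)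

text \<open>
  Truncations of the series for \<open>\<partial>\<^sub>r\<phi>\<close> and \<open>\<partial>\<^sub>\<theta>\<phi>\<close>, where \<open>\<phi>\<close> has the Fourier coefficients
  \<open>c\<close> on the circle of radius \<open>R\<close>.
\<close>

definition radial_trunc :: "real \<Rightarrow> real \<Rightarrow> (int \<Rightarrow> complex) \<Rightarrow> int \<Rightarrow> real \<Rightarrow> real \<Rightarrow> complex" where
  "radial_trunc k R c N r \<theta> = (\<Sum>n\<in>{-N..N}. alpha k R n r * c n * cis (of_int n * \<theta>))"

definition angular_trunc :: "real \<Rightarrow> real \<Rightarrow> (int \<Rightarrow> complex) \<Rightarrow> int \<Rightarrow> real \<Rightarrow> real \<Rightarrow> complex" where
  "angular_trunc k R c N r \<theta> = (\<Sum>n\<in>{-N..N}. \<i> * of_int n * beta k R n r * c n * cis (of_int n * \<theta>))"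

lemma field_trunc_split:
  "field_trunc k_p k_s R a b N r \<theta> =
    (radial_trunc k_p R a N r \<theta> + angular_trunc k_s R b N r \<theta> / of_real r) *s e_r \<theta>
  + (angular_trunc k_p R a N r \<theta> / of_real r - radial_trunc k_s R b N r \<theta>) *s e_theta \<theta>"
  unfolding field_trunc_def U_mode_def V_mode_def radial_trunc_def angular_trunc_def sum_divide_distrib
    sum.distrib[symmetric] sum_subtractf[symmetric] vec.scale_sum_left
  by (intro sum.cong refl) (simp add: vec_eq_iff algebra_simps)

lemma norm_polar_frame_le: "norm (x *s e_r \<theta> + y *s e_theta \<theta>) \<le> norm x + norm y"
proof -
  have "norm (z *s e_r \<theta>) = norm z" "norm (z *s e_theta \<theta>) = norm z" for z
    by (simp_all add: norm_vec_def L2_set_def sum_2 e_r_def e_theta_def norm_mult power_mult_distrib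
        flip: distrib_left)
  then show ?thesis by (metis norm_triangle_ineq)
qed

text \<open>
  The constant must not depend on \<open>r\<close>, because the estimate is later used for \<open>r \<longlongrightarrow> \<rho>\<close> from the
  right. For this reason the decay is measured by the single ratio \<open>R/\<rho>\<close>, which dominates
  \<open>R/r\<close> for all \<open>r > \<rho>\<close>.
\<close>

lemma potential_derivs_truncation:
  fixes \<phi> :: "real^2 \<Rightarrow> complex"
  assumes "k > 0" "R > 0" "R < \<rho>" and A: "\<And>n. norm (a n) \<le> A"
    and series: "\<And>r \<theta>. r > R \<Longrightarrow> ((\<lambda>n. beta k R n r * a n * cis (of_int n * \<theta>)) has_sum \<phi> (polar r \<theta>)) UNIV"
  shows "\<exists>C>0. \<forall>r \<theta>. \<rho> < r \<and> r < \<rho> + 1 \<longrightarrow> (\<exists>Dr Dt.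
     ((\<lambda>s. \<phi> (polar s \<theta>)) has_vector_derivative Dr) (at r) \<and>
     ((\<lambda>t. \<phi> (polar r t)) has_vector_derivative Dt) (at \<theta>) \<and>
     (\<forall>N\<ge>1. norm (Dr - radial_trunc k R a (int N) r \<theta>) \<le> C * (real N * (R / \<rho>) ^ N) \<and>
             norm (Dt - angular_trunc k R a (int N) r \<theta>) \<le> C * (real N * (R / \<rho>) ^ N)))"
proof -
  let ?q = "R / \<rho>"
  have \<rho>: "\<rho> > 0" using assms by simp
  have q: "0 \<le> ?q" "?q < 1" using assms by auto
  obtain K where K: "K > 0"
    "\<And>n r. \<rho> \<le> r \<Longrightarrow> r \<le> \<rho> + 1 \<Longrightarrow> norm (beta k R n r) \<le> K * (R / r) ^ nat \<bar>n\<bar>"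
    "\<And>n r. \<rho> \<le> r \<Longrightarrow> r \<le> \<rho> + 1 \<Longrightarrow> norm (alpha k R n r) \<le> K * (real (nat \<bar>n\<bar>) + 1) * (R / r) ^ nat \<bar>n\<bar>"
    using radial_factor_bounds[OF assms(1,2) \<rho>, of "\<rho> + 1"] by metis
  have A0: "A \<ge> 0" using A[of 0] norm_ge_zero order.trans by blast
  then have KA: "K * A \<ge> 0" using K by simp
  have qpow: "(R / r) ^ m \<le> ?q ^ m" if "\<rho> < r" for r m
    using that assms by (intro power_mono divide_left_mono) auto
  have alpha_le: "norm (alpha k R n r * a n * cis (of_int n * \<theta>)) \<le> K * A * (real (nat \<bar>n\<bar>) + 1) * ?q ^ nat \<bar>n\<bar>"
    if "\<rho> < r" "r < \<rho> + 1" for n r \<theta>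
  proof -
    have "norm (alpha k R n r) \<le> K * (real (nat \<bar>n\<bar>) + 1) * ?q ^ nat \<bar>n\<bar>"
      using that K(1) by (intro order.trans[OF K(3)] mult_left_mono qpow) auto
    from mult_mono[OF this A[of n]] show ?thesis
      using K q by (simp add: norm_mult mult_ac)
  qed
  have beta_le: "norm (\<i> * of_int n * beta k R n r * a n * cis (of_int n * \<theta>)) \<le> K * A * (real (nat \<bar>n\<bar>) + 1) * ?q ^ nat \<bar>n\<bar>"
    if "\<rho> < r" "r < \<rho> + 1" for n r \<theta>
  proof -
    have "norm (beta k R n r) \<le> K * ?q ^ nat \<bar>n\<bar>"
      using that K(1) by (intro order.trans[OF K(2)] mult_left_mono qpow) auto
    from mult_mono[OF this A[of n]] have "norm (beta k R n r) * norm (a n) \<le> K * ?q ^ nat \<bar>n\<bar> * A"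
      using K q by simp
    then have "(real (nat \<bar>n\<bar>) + 1) * (norm (beta k R n r) * norm (a n)) \<le> (real (nat \<bar>n\<bar>) + 1) * (K * ?q ^ nat \<bar>n\<bar> * A)"
      by (intro mult_left_mono) auto
    moreover have "norm (\<i> * of_int n * beta k R n r * a n * cis (of_int n * \<theta>)) = real (nat \<bar>n\<bar>) * (norm (beta k R n r) * norm (a n))"
      by (simp add: norm_mult)
    moreover have "real (nat \<bar>n\<bar>) * (norm (beta k R n r) * norm (a n)) \<le> (real (nat \<bar>n\<bar>) + 1) * (norm (beta k R n r) * norm (a n))"
      by (intro mult_right_mono) auto
    ultimately show ?thesis by (simp add: mult_ac)
  qed
  (* The summand 1 keeps C positive when all coefficients vanish. *)
  define C where "C = 6 * (K * A) / (1 - ?q)\<^sup>2 + 1"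
  have C: "C > 0" unfolding C_def using KA by (intro add_nonneg_pos) auto
  show ?thesis
  proof (intro exI conjI allI impI)
    show "C > 0" by (rule C)
    fix r \<theta> assume "\<rho> < r \<and> r < \<rho> + 1"
    then have r: "\<rho> < r" "r < \<rho> + 1" by auto
    show "((\<lambda>s. \<phi> (polar s \<theta>)) has_vector_derivative
        (\<Sum>m. sym_pair (\<lambda>n. alpha k R n r * a n * cis (of_int n * \<theta>)) m)) (at r)"
    proof (rule sym_pair_termwise_deriv[where a = \<rho> and b = "\<rho> + 1" and f = "\<lambda>n r. beta k R n r * a n * cis (of_int n * \<theta>)"
          and g = "\<lambda>n r. alpha k R n r * a n * cis (of_int n * \<theta>)"])
      show "((\<lambda>r. beta k R n r * a n * cis (of_int n * \<theta>)) has_vector_derivative alpha k R n s * a n * cis (of_int n * \<theta>)) (at s)"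
        if "\<rho> < s" for n s
        using that assms by (intro has_vector_derivative_mult_left beta_has_deriv) auto
      show "sym_pair (\<lambda>n. beta k R n s * a n * cis (of_int n * \<theta>)) sums \<phi> (polar s \<theta>)" if "\<rho> < s" for s
        using that assms by (intro has_sum_imp_sym_pair_sums series) auto
    qed (use alpha_le KA q r in auto)
    show "((\<lambda>t. \<phi> (polar r t)) has_vector_derivative
        (\<Sum>m. sym_pair (\<lambda>n. \<i> * of_int n * beta k R n r * a n * cis (of_int n * \<theta>)) m)) (at \<theta>)"
    proof (rule sym_pair_termwise_deriv[where a = "\<theta> - 1" and b = "\<theta> + 1" and f = "\<lambda>n t. beta k R n r * a n * cis (of_int n * t)"
          and g = "\<lambda>n t. \<i> * of_int n * beta k R n r * a n * cis (of_int n * t)"])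
      show "((\<lambda>t. beta k R n r * a n * cis (of_int n * t)) has_vector_derivative \<i> * of_int n * beta k R n r * a n * cis (of_int n * t)) (at t)"
        for n t
      proof -
        have "((\<lambda>t. cis (of_int n * t)) has_vector_derivative of_int n *\<^sub>R (\<i> * cis (of_int n * t))) (at t)"
          unfolding cis_conv_exp by (auto intro!: derivative_eq_intros has_vector_derivative_real_field simp: scaleR_conv_of_real mult_ac)
        from has_vector_derivative_mult_right[OF this, of "beta k R n r * a n"]
        show ?thesis by (simp add: scaleR_conv_of_real mult_ac)
      qed
      show "sym_pair (\<lambda>n. beta k R n r * a n * cis (of_int n * t)) sums \<phi> (polar r t)" for t
        using r assms by (intro has_sum_imp_sym_pair_sums series) auto
    qed (use beta_le KA q r in auto)
    fix N :: nat assume N: "N \<ge> 1"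
    have le: "6 * (K * A) / (1 - ?q)\<^sup>2 * real N * ?q ^ N \<le> C * (real N * ?q ^ N)"
      unfolding C_def mult.assoc[symmetric] using q by (intro mult_right_mono) auto
    show "norm ((\<Sum>m. sym_pair (\<lambda>n. alpha k R n r * a n * cis (of_int n * \<theta>)) m) - radial_trunc k R a (int N) r \<theta>)
        \<le> C * (real N * ?q ^ N)"
      unfolding radial_trunc_def by (rule order.trans[OF sym_pair_tail_bound[OF alpha_le[OF r] KA q N] le])
    show "norm ((\<Sum>m. sym_pair (\<lambda>n. \<i> * of_int n * beta k R n r * a n * cis (of_int n * \<theta>)) m) - angular_trunc k R a (int N) r \<theta>)
        \<le> C * (real N * ?q ^ N)"
      unfolding angular_trunc_def by (rule order.trans[OF sym_pair_tail_bound[OF beta_le[OF r] KA q N] le])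
  qed
qed

section \<open>Fourier modes on a circle\<close>

lemma cis_mode_has_integral:
  "((\<lambda>\<theta>. cis (of_int m * \<theta>)) has_integral (if m = 0 then 2 * of_real pi else 0)) {0..2*pi}"
proof (cases "m = 0")
  case True
  then show ?thesis using has_integral_const_real[of "1::complex" 0 "2 * pi"]
    by (simp add: scaleR_conv_of_real)
next
  case False
  have "((\<lambda>\<theta>. cis (of_int m * \<theta>)) has_integral
      (cis (of_int m * (2 * pi)) / (\<i> * of_int m) - cis (of_int m * 0) / (\<i> * of_int m))) {0..2*pi}"
  proof (rule fundamental_theorem_of_calculus)
    fix x :: real
    have "((\<lambda>t. cis (of_int m * t)) has_vector_derivative of_int m *\<^sub>R (\<i> * cis (of_int m * x))) (at x within {0..2*pi})"
      unfolding cis_conv_exp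
      by (auto intro!: derivative_eq_intros has_vector_derivative_real_field simp: scaleR_conv_of_real mult_ac)
    from has_vector_derivative_divide[OF this, of "\<i> * of_int m"]
    show "((\<lambda>t. cis (of_int m * t) / (\<i> * of_int m)) has_vector_derivative cis (of_int m * x)) (at x within {0..2*pi})"
      using False by (simp add: scaleR_conv_of_real mult_ac)
  qed simp
  then show ?thesis using False by (simp add: cis_multiple_2pi[of "of_int m", simplified mult.commute[of _ "of_int m"]])
qed

lemma norm_square_trig_poly_has_integral:
  assumes "finite F"
  shows "((\<lambda>\<theta>. (norm (\<Sum>n\<in>F. c n * cis (of_int n * \<theta>)))\<^sup>2) has_integral 2 * pi * (\<Sum>n\<in>F. (norm (c n))\<^sup>2)) {0..2*pi}"
proof -
  have "((\<lambda>\<theta>. \<Sum>n\<in>F. \<Sum>m\<in>F. c n * cnj (c m) * cis (of_int (n - m) * \<theta>)) has_integral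
     (\<Sum>n\<in>F. \<Sum>m\<in>F. c n * cnj (c m) * (if n - m = 0 then 2 * of_real pi else 0))) {0..2*pi}"
    by (intro has_integral_sum has_integral_mult_right cis_mode_has_integral assms)
  also have "(\<Sum>n\<in>F. \<Sum>m\<in>F. c n * cnj (c m) * (if n - m = 0 then 2 * of_real pi else 0))
     = of_real (2 * pi * (\<Sum>n\<in>F. (norm (c n))\<^sup>2))"
  proof -
    have "(\<Sum>m\<in>F. c n * cnj (c m) * (if n - m = 0 then 2 * of_real pi else 0)) = of_real (2 * pi * (norm (c n))\<^sup>2)"
      if "n \<in> F" for n
    proof -
      have "(\<Sum>m\<in>F. c n * cnj (c m) * (if n - m = 0 then 2 * of_real pi else 0)) =
        (\<Sum>m\<in>F. if m = n then c n * cnj (c n) * (2 * of_real pi) else 0)"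
        by (intro sum.cong) auto
      then show ?thesis using that assms by (simp flip: complex_norm_square)
    qed
    then show ?thesis by (simp add: sum_distrib_left)
  qed
  also have "(\<lambda>\<theta>. \<Sum>n\<in>F. \<Sum>m\<in>F. c n * cnj (c m) * cis (of_int (n - m) * \<theta>)) =
     (\<lambda>\<theta>. of_real ((norm (\<Sum>n\<in>F. c n * cis (of_int n * \<theta>)))\<^sup>2))"
  proof
    fix \<theta>
    have "cis (of_int (n - m) * \<theta>) = cis (of_int n * \<theta>) * cnj (cis (of_int m * \<theta>))" for n m
      by (simp add: cis_mult cis_cnj algebra_simps)
    then show "(\<Sum>n\<in>F. \<Sum>m\<in>F. c n * cnj (c m) * cis (of_int (n - m) * \<theta>)) =
        of_real ((norm (\<Sum>n\<in>F. c n * cis (of_int n * \<theta>)))\<^sup>2)"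
      unfolding complex_norm_square cnj_sum sum_product by (intro sum.cong refl) (simp add: mult_ac)
  qed
  finally show ?thesis by (auto dest: has_integral_Re)
qed

text \<open>
  On a set of finite measure square integrability implies integrability, by
  \<open>t \<le> 1 + t\<^sup>2\<close>.
\<close>

lemma L2_circle_imp_integrable:
  fixes f :: "real \<Rightarrow> complex"
  assumes "L2_circle f"
  shows "set_integrable lebesgue {0..2*pi} (\<lambda>\<theta>. f \<theta> * cis (- (of_int n * \<theta>)))"
proof (rule set_integrable_bound)
  show "set_integrable lebesgue {0..2*pi} (\<lambda>\<theta>. 1 + (norm (f \<theta>))\<^sup>2)"
    using assms by (intro set_integral_add absolutely_integrable_on_const) (auto simp: L2_circle_def)
  have "(\<lambda>\<theta>. cis (- (of_int n * \<theta>))) \<in> borel_measurable lebesgue"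
    by (intro measurable_completion) (auto intro!: borel_measurable_continuous_onI continuous_intros)
  moreover have "(\<lambda>\<theta>. indicator {0..2*pi} \<theta> *\<^sub>R f \<theta>) \<in> borel_measurable lebesgue"
    using assms by (simp add: L2_circle_def set_borel_measurable_def)
  ultimately have "(\<lambda>\<theta>. (indicator {0..2*pi} \<theta> *\<^sub>R f \<theta>) * cis (- (of_int n * \<theta>))) \<in> borel_measurable lebesgue"
    by (intro borel_measurable_times)
  then show "set_borel_measurable lebesgue {0..2*pi} (\<lambda>\<theta>. f \<theta> * cis (- (of_int n * \<theta>)))"
    by (simp add: set_borel_measurable_def)
  have "t \<le> 1 + t\<^sup>2" for t :: real
    using sum_power2_ge_zero[of "t - 1" t] by (sos)
  then show "AE \<theta> in lebesgue. \<theta> \<in> {0..2*pi} \<longrightarrow> norm (f \<theta> * cis (- (of_int n * \<theta>))) \<le> norm (1 + (norm (f \<theta>))\<^sup>2)"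
    by (simp add: norm_mult)
qed

text \<open>
  With \<open>s\<close> the partial Fourier sum, integrate \<open>2 Re (f cnj s) \<le> |f|\<^sup>2 + |s|\<^sup>2\<close>: the left side gives
  twice, the last term once, \<open>2\<pi>\<close> times the sum of the squared coefficients.
\<close>

lemma bessel_inequality:
  fixes f :: "real \<Rightarrow> complex"
  assumes "L2_circle f" "finite F"
  shows "2 * pi * (\<Sum>n\<in>F. (norm (fourier_coeff f n))\<^sup>2) \<le> (LINT \<theta>:{0..2*pi}|lebesgue. (norm (f \<theta>))\<^sup>2)"
proof -
  let ?a = "fourier_coeff f"
  let ?s = "\<lambda>\<theta>. \<Sum>n\<in>F. ?a n * cis (of_int n * \<theta>)"
  have "((\<lambda>\<theta>. f \<theta> * cis (- (of_int n * \<theta>))) has_integral 2 * of_real pi * ?a n) {0..2*pi}" for n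
    using has_integral_set_lebesgue[OF L2_circle_imp_integrable[OF assms(1), of n]]
    by (simp add: fourier_coeff_def)
  then have "((\<lambda>\<theta>. \<Sum>n\<in>F. cnj (?a n) * (f \<theta> * cis (- (of_int n * \<theta>)))) has_integral
      (\<Sum>n\<in>F. cnj (?a n) * (2 * of_real pi * ?a n))) {0..2*pi}"
    by (intro has_integral_sum has_integral_mult_right assms(2))
  also have "(\<lambda>\<theta>. \<Sum>n\<in>F. cnj (?a n) * (f \<theta> * cis (- (of_int n * \<theta>)))) = (\<lambda>\<theta>. f \<theta> * cnj (?s \<theta>))"
    by (simp add: fun_eq_iff sum_distrib_left cis_cnj mult_ac)
  also have "(\<Sum>n\<in>F. cnj (?a n) * (2 * of_real pi * ?a n)) = of_real (2 * pi * (\<Sum>n\<in>F. (norm (?a n))\<^sup>2))"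
    unfolding of_real_mult of_real_sum complex_norm_square sum_distrib_left by (intro sum.cong) simp_all
  finally have "((\<lambda>\<theta>. Re (f \<theta> * cnj (?s \<theta>))) has_integral 2 * pi * (\<Sum>n\<in>F. (norm (?a n))\<^sup>2)) {0..2*pi}"
    by (auto dest: has_integral_Re)
  then have L: "((\<lambda>\<theta>. 2 * Re (f \<theta> * cnj (?s \<theta>))) has_integral 2 * (2 * pi * (\<Sum>n\<in>F. (norm (?a n))\<^sup>2))) {0..2*pi}"
    by (rule has_integral_mult_right)
  have "((\<lambda>\<theta>. (norm (f \<theta>))\<^sup>2) has_integral (LINT \<theta>:{0..2*pi}|lebesgue. (norm (f \<theta>))\<^sup>2)) {0..2*pi}"
    using assms by (intro has_integral_set_lebesgue) (simp add: L2_circle_def)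
  from has_integral_add[OF this norm_square_trig_poly_has_integral[OF assms(2), of ?a]]
  have U: "((\<lambda>\<theta>. (norm (f \<theta>))\<^sup>2 + (norm (?s \<theta>))\<^sup>2) has_integral
     (LINT \<theta>:{0..2*pi}|lebesgue. (norm (f \<theta>))\<^sup>2) + 2 * pi * (\<Sum>n\<in>F. (norm (?a n))\<^sup>2)) {0..2*pi}" .
  have le: "2 * Re (z * cnj w) \<le> (norm z)\<^sup>2 + (norm w)\<^sup>2" for z w
  proof -
    have "0 \<le> (Re z - Re w)\<^sup>2 + (Im z - Im w)\<^sup>2" by simp
    then show ?thesis by (simp add: cmod_power2 power2_diff)
  qed
  from has_integral_le[OF L U le] show ?thesis by linarith
qed

lemma norm_square_polar_frame: "(norm (x *s e_r \<theta> + y *s e_theta \<theta>))\<^sup>2 = (norm x)\<^sup>2 + (norm y)\<^sup>2"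
proof -
  define c d where "c = cos \<theta>" and "d = sin \<theta>"
  have cd: "c\<^sup>2 + d\<^sup>2 = 1" by (simp add: c_def d_def)
  have "(norm (x *s e_r \<theta> + y *s e_theta \<theta>))\<^sup>2 = (norm (x * of_real c - y * of_real d))\<^sup>2 + (norm (x * of_real d + y * of_real c))\<^sup>2"
    by (simp add: norm_vec_def L2_set_def sum_2 e_r_def e_theta_def c_def d_def)
  also have "\<dots> = (c\<^sup>2 + d\<^sup>2) * ((norm x)\<^sup>2 + (norm y)\<^sup>2)"
    unfolding cmod_power2 by (simp add: power2_eq_square algebra_simps)
  finally show ?thesis by (simp add: cd)
qed

text \<open>
  Grouping by Fourier modes, as needed for orthogonality; \<open>field_trunc_split\<close> groups the same sum by
  potentials, as needed for comparison with their derivatives.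
\<close>

lemma field_trunc_modes:
  "field_trunc k_p k_s R a b N r \<theta> =
    (\<Sum>n\<in>{-N..N}. (alpha k_p R n r * a n + \<i> * of_int n / of_real r * beta k_s R n r * b n) * cis (of_int n * \<theta>)) *s e_r \<theta>
  + (\<Sum>n\<in>{-N..N}. (\<i> * of_int n / of_real r * beta k_p R n r * a n - alpha k_s R n r * b n) * cis (of_int n * \<theta>)) *s e_theta \<theta>"
  unfolding field_trunc_def U_mode_def V_mode_def sum.distrib vec.scale_sum_left
  by simp

lemma field_trunc_norm_square_has_integral:
  "((\<lambda>\<theta>. (norm (field_trunc k_p k_s R a b N r \<theta>))\<^sup>2) has_integral
     2 * pi * (\<Sum>n\<in>{-N..N}. (norm (alpha k_p R n r * a n + \<i> * of_int n / of_real r * beta k_s R n r * b n))\<^sup>2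
                 + (norm (\<i> * of_int n / of_real r * beta k_p R n r * a n - alpha k_s R n r * b n))\<^sup>2)) {0..2*pi}"
  unfolding field_trunc_modes norm_square_polar_frame sum.distrib distrib_left
  by (intro has_integral_add norm_square_trig_poly_has_integral) auto

lemma continuous_on_polar_frame:
  assumes "continuous_on S x" "continuous_on S y"
  shows "continuous_on S (\<lambda>\<theta>. x \<theta> *s e_r \<theta> + y \<theta> *s e_theta \<theta>)"
proof -
  have comp: "continuous_on S (\<lambda>\<theta>. (x \<theta> *s e_r \<theta> + y \<theta> *s e_theta \<theta>) $ 1)"
       "continuous_on S (\<lambda>\<theta>. (x \<theta> *s e_r \<theta> + y \<theta> *s e_theta \<theta>) $ 2)"
    unfolding e_r_def e_theta_def vector_add_component vector_smult_component vector_2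
    by (intro continuous_intros assms)+
  have "continuous_on S (\<lambda>\<theta>. (x \<theta> *s e_r \<theta> + y \<theta> *s e_theta \<theta>) $ i)" for i
    by (rule disjE[OF exhaust_2[of i]]) (simp_all only: comp)
  then show ?thesis unfolding continuous_on_def by (blast intro: vec_tendstoI)
qed

lemma continuous_on_field_trunc: "continuous_on S (field_trunc k_p k_s R a b N r)"
proof -
  have trig: "continuous_on S (\<lambda>\<theta>. \<Sum>n\<in>F. c n * cis (of_int n * \<theta>))" for F c
    by (intro continuous_intros)
  show ?thesis
    unfolding field_trunc_modes[abs_def] by (rule continuous_on_polar_frame[OF trig trig])
qed

lemma field_trunc_radially_isCont:
  assumes "k_p > 0" "k_s > 0" "R > 0" "r > 0"
  shows "isCont (\<lambda>r. field_trunc k_p k_s R a b N r \<theta>) r"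
proof -
  have "isCont (beta k_p R n) r" "isCont (beta k_s R n) r" for n
    using beta_has_deriv has_vector_derivative_continuous assms by blast+
  then have "isCont (\<lambda>r. field_trunc k_p k_s R a b N r \<theta> $ i) r" for i
    using alpha_isCont[OF assms(1,3,4)] alpha_isCont[OF assms(2,3,4)] assms(4)
    unfolding field_trunc_modes vector_add_component vector_smult_component
    by (intro continuous_intros) auto
  then show ?thesis unfolding isCont_def by (intro vec_tendstoI)
qed

lemma continuous_on_polar: "continuous_on S (polar r)"
  unfolding continuous_on_eq_continuous_within
  by (intro ballI has_vector_derivative_continuous[OF polar_has_angular_deriv])

lemma L2_circle_continuous:
  fixes f :: "real \<Rightarrow> 'a::euclidean_space"
  assumes "continuous_on {0..2*pi} f"
  shows "L2_circle f"
proof -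
  have "set_integrable lebesgue {0..2*pi} f" "set_integrable lebesgue {0..2*pi} (\<lambda>\<theta>. (norm (f \<theta>))\<^sup>2)"
    using assms by (auto intro!: absolutely_integrable_continuous_real continuous_intros)
  then show ?thesis
    unfolding L2_circle_def set_borel_measurable_def set_integrable_def by (auto dest: borel_measurable_integrable)
qed

lemma L2_circle_norm_square:
  fixes f :: "real \<Rightarrow> 'a::euclidean_space"
  assumes "continuous_on {0..2*pi} f" "r \<ge> 0"
  shows "(L2_circle_norm r f)\<^sup>2 = r * integral {0..2*pi} (\<lambda>\<theta>. (norm (f \<theta>))\<^sup>2)"
proof -
  have "(LINT \<theta>:{0..2*pi}|lebesgue. (norm (f \<theta>))\<^sup>2) = integral {0..2*pi} (\<lambda>\<theta>. (norm (f \<theta>))\<^sup>2)"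
    using assms(1)
    by (intro set_lebesgue_integral_eq_integral absolutely_integrable_continuous_real continuous_intros)
  moreover have "integral {0..2*pi} (\<lambda>\<theta>. (norm (f \<theta>))\<^sup>2) \<ge> 0"
    using assms(1) by (intro integral_nonneg integrable_continuous_interval continuous_intros) auto
  ultimately show ?thesis using assms(2) by (simp add: L2_circle_norm_def)
qed

section \<open>Truncation error of the field\<close>

lemma exterior_field_truncation_error:
  fixes \<phi>p \<phi>s :: "real^2 \<Rightarrow> complex"
  assumes "k_p > 0" "k_s > 0" "R > 0" "R < \<rho>"
    and A: "\<And>n. norm (a n) \<le> A" "\<And>n. norm (b n) \<le> A"
    and series: "\<And>r \<theta>. r > R \<Longrightarrow> ((\<lambda>n. beta k_p R n r * a n * cis (of_int n * \<theta>)) has_sum \<phi>p (polar r \<theta>)) UNIV"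
      "\<And>r \<theta>. r > R \<Longrightarrow> ((\<lambda>n. beta k_s R n r * b n * cis (of_int n * \<theta>)) has_sum \<phi>s (polar r \<theta>)) UNIV"
    and diff: "\<And>r \<theta>. r > \<rho> \<Longrightarrow> \<phi>p differentiable (at (polar r \<theta>))"
      "\<And>r \<theta>. r > \<rho> \<Longrightarrow> \<phi>s differentiable (at (polar r \<theta>))"
  obtains C where "C > 0" "\<And>r \<theta> N. \<rho> < r \<Longrightarrow> r < \<rho> + 1 \<Longrightarrow> N \<ge> 1 \<Longrightarrow>
    norm (grad \<phi>p (polar r \<theta>) + vcurl \<phi>s (polar r \<theta>) - field_trunc k_p k_s R a b (int N) r \<theta>)
      \<le> C * real N * (R / \<rho>) ^ N"
proof -
  obtain Cp where Cp: "Cp > 0" "\<forall>r \<theta>. \<rho> < r \<and> r < \<rho> + 1 \<longrightarrow> (\<exists>Dr Dt.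
     ((\<lambda>s. \<phi>p (polar s \<theta>)) has_vector_derivative Dr) (at r) \<and>
     ((\<lambda>t. \<phi>p (polar r t)) has_vector_derivative Dt) (at \<theta>) \<and>
     (\<forall>N\<ge>1. norm (Dr - radial_trunc k_p R a (int N) r \<theta>) \<le> Cp * (real N * (R / \<rho>) ^ N) \<and>
             norm (Dt - angular_trunc k_p R a (int N) r \<theta>) \<le> Cp * (real N * (R / \<rho>) ^ N)))"
    using potential_derivs_truncation[OF assms(1,3,4) A(1) series(1)] by blast
  obtain Cs where Cs: "Cs > 0" "\<forall>r \<theta>. \<rho> < r \<and> r < \<rho> + 1 \<longrightarrow> (\<exists>Dr Dt.
     ((\<lambda>s. \<phi>s (polar s \<theta>)) has_vector_derivative Dr) (at r) \<and>
     ((\<lambda>t. \<phi>s (polar r t)) has_vector_derivative Dt) (at \<theta>) \<and>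
     (\<forall>N\<ge>1. norm (Dr - radial_trunc k_s R b (int N) r \<theta>) \<le> Cs * (real N * (R / \<rho>) ^ N) \<and>
             norm (Dt - angular_trunc k_s R b (int N) r \<theta>) \<le> Cs * (real N * (R / \<rho>) ^ N)))"
    using potential_derivs_truncation[OF assms(2,3,4) A(2) series(2)] by blast
  have \<rho>: "\<rho> > 0" using assms by simp
  define C where "C = (Cp + Cs) * (1 + 1 / \<rho>)"
  show ?thesis
  proof (rule that)
    show "C > 0" unfolding C_def using Cp Cs \<rho> by (intro mult_pos_pos add_pos_pos) auto
    fix r \<theta> and N :: nat assume r: "\<rho> < r" "r < \<rho> + 1" and N: "N \<ge> 1"
    let ?e = "real N * (R / \<rho>) ^ N"
    let ?ar = "radial_trunc k_p R a (int N) r \<theta>"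
    let ?at = "angular_trunc k_p R a (int N) r \<theta>"
    let ?br = "radial_trunc k_s R b (int N) r \<theta>"
    let ?bt = "angular_trunc k_s R b (int N) r \<theta>"
    obtain pr pt where p: "((\<lambda>s. \<phi>p (polar s \<theta>)) has_vector_derivative pr) (at r)"
      "((\<lambda>t. \<phi>p (polar r t)) has_vector_derivative pt) (at \<theta>)"
      "norm (pr - ?ar) \<le> Cp * ?e" "norm (pt - ?at) \<le> Cp * ?e"
      using Cp(2) r N by blast
    obtain sr st where s: "((\<lambda>s. \<phi>s (polar s \<theta>)) has_vector_derivative sr) (at r)"
      "((\<lambda>t. \<phi>s (polar r t)) has_vector_derivative st) (at \<theta>)"
      "norm (sr - ?br) \<le> Cs * ?e" "norm (st - ?bt) \<le> Cs * ?e"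
      using Cs(2) r N by blast
    have r0: "r > 0" using r \<rho> by simp
    have div: "norm (z / of_real r) \<le> c / \<rho>" if "norm z \<le> c" for z :: complex and c
      using that r \<rho> r0 order.trans[OF norm_ge_zero that] by (auto simp: norm_divide intro!: frac_le)
    have "grad \<phi>p (polar r \<theta>) + vcurl \<phi>s (polar r \<theta>) - field_trunc k_p k_s R a b (int N) r \<theta>
      = ((pr - ?ar) + (st - ?bt) / of_real r) *s e_r \<theta> + ((pt - ?at) / of_real r - (sr - ?br)) *s e_theta \<theta>"
      unfolding field_trunc_split grad_plus_vcurl_polar[OF diff(1)[OF r(1)] diff(2)[OF r(1)] r0 p(1,2) s(1,2)]
      by (simp only: vec_eq_iff vector_add_component vector_minus_component vector_smult_component)
         (simp add: algebra_simps diff_divide_distrib)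
    also have "norm \<dots> \<le> norm ((pr - ?ar) + (st - ?bt) / of_real r) + norm ((pt - ?at) / of_real r - (sr - ?br))"
      by (rule norm_polar_frame_le)
    also have "\<dots> \<le> (Cp * ?e + Cs * ?e / \<rho>) + (Cp * ?e / \<rho> + Cs * ?e)"
      by (rule add_mono[OF norm_triangle_mono[OF p(3) div[OF s(4)]]
            order.trans[OF norm_triangle_ineq4 add_mono[OF div[OF p(4)] s(3)]]])
    also have "\<dots> = C * real N * (R / \<rho>) ^ N" by (simp add: C_def algebra_simps add_divide_distrib)
    finally show "norm (grad \<phi>p (polar r \<theta>) + vcurl \<phi>s (polar r \<theta>) - field_trunc k_p k_s R a b (int N) r \<theta>)
      \<le> C * real N * (R / \<rho>) ^ N" .
  qed
qed

text \<open>
  On the circle of radius \<open>\<rho>\<close> only the continuity of \<open>v\<close> from outside is available; the bound is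
  a limit of the bounds on slightly larger circles.
\<close>

lemma boundary_truncation_error:
  fixes v :: "real^2 \<Rightarrow> complex^2"
  assumes "k_p > 0" "k_s > 0" "R > 0" "\<rho> > 0"
    and cont: "continuous_on (- ball 0 \<rho>) v"
    and err: "\<And>r. \<rho> < r \<Longrightarrow> r < \<rho> + 1 \<Longrightarrow> norm (v (polar r \<theta>) - field_trunc k_p k_s R a b N r \<theta>) \<le> E"
  shows "norm (v (polar \<rho> \<theta>) - field_trunc k_p k_s R a b N \<rho> \<theta>) \<le> E"
proof (rule tendsto_upperbound)
  have "((\<lambda>r. v (polar r \<theta>)) \<longlongrightarrow> v (polar \<rho> \<theta>)) (at \<rho> within {\<rho>..})"
  proof (rule continuous_on_tendsto_compose[OF cont])
    show "((\<lambda>r. polar r \<theta>) \<longlongrightarrow> polar \<rho> \<theta>) (at \<rho> within {\<rho>..})"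
      using has_vector_derivative_continuous[OF polar_has_radial_deriv] by (simp add: continuous_within)
    show "\<forall>\<^sub>F r in at \<rho> within {\<rho>..}. polar r \<theta> \<in> - ball 0 \<rho>"
      using assms(4) by (auto simp: eventually_at_filter)
  qed (use assms(4) in simp)
  then have "((\<lambda>r. v (polar r \<theta>)) \<longlongrightarrow> v (polar \<rho> \<theta>)) (at_right \<rho>)"
    by (rule tendsto_within_subset) auto
  moreover have "((\<lambda>r. field_trunc k_p k_s R a b N r \<theta>) \<longlongrightarrow> field_trunc k_p k_s R a b N \<rho> \<theta>) (at_right \<rho>)"
    by (rule tendsto_within_subset[OF field_trunc_radially_isCont[OF assms(1-4), unfolded isCont_def] subset_UNIV])
  ultimately show "((\<lambda>r. norm (v (polar r \<theta>) - field_trunc k_p k_s R a b N r \<theta>)) \<longlongrightarrow>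
      norm (v (polar \<rho> \<theta>) - field_trunc k_p k_s R a b N \<rho> \<theta>)) (at_right \<rho>)"
    by (intro tendsto_intros)
  show "\<forall>\<^sub>F r in at_right \<rho>. norm (v (polar r \<theta>) - field_trunc k_p k_s R a b N r \<theta>) \<le> E"
    using err unfolding eventually_at_right_field by (intro exI[of _ "\<rho> + 1"]) auto
qed simp

text \<open>
  At \<open>r = R\<close> the radial factors grow at most linearly in \<open>n\<close>. By orthogonality the squared norm of
  the truncation is then at most a multiple of \<open>N\<^sup>2\<close> times the sum of the squared Fourier
  coefficients, which Bessel's inequality bounds independently of \<open>N\<close>.
\<close>

lemma field_trunc_norm_at_R:
  fixes f g :: "real \<Rightarrow> complex"
  assumes "k_p > 0" "k_s > 0" "R > 0" and L2: "L2_circle f" "L2_circle g"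
  obtains C where "C > 0" "\<And>N. N \<ge> 1 \<Longrightarrow> integral {0..2*pi} (\<lambda>\<theta>. (norm (field_trunc k_p k_s R (fourier_coeff f) (fourier_coeff g) N R \<theta>))\<^sup>2)
     \<le> C * (of_int N)\<^sup>2"
proof -
  let ?a = "fourier_coeff f" and ?b = "fourier_coeff g"
  let ?L = "(LINT \<theta>:{0..2*pi}|lebesgue. (norm (f \<theta>))\<^sup>2) + (LINT \<theta>:{0..2*pi}|lebesgue. (norm (g \<theta>))\<^sup>2)"
  obtain Kp where Kp: "Kp > 0" "\<And>n. norm (beta k_p R n R) \<le> Kp" "\<And>n. norm (alpha k_p R n R) \<le> Kp * (real (nat \<bar>n\<bar>) + 1)"
    using radial_factor_bounds[OF assms(1,3,3), of R] assms(3)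
    by (metis (no_types, opaque_lifting) div_self less_irrefl mult.right_neutral order.refl power_one)
  obtain Ks where Ks: "Ks > 0" "\<And>n. norm (beta k_s R n R) \<le> Ks" "\<And>n. norm (alpha k_s R n R) \<le> Ks * (real (nat \<bar>n\<bar>) + 1)"
    using radial_factor_bounds[OF assms(2,3,3), of R] assms(3)
    by (metis (no_types, opaque_lifting) div_self less_irrefl mult.right_neutral order.refl power_one)
  (* K dominates Kp, Ks, Kp / R and Ks / R. *)
  define K where "K = (Kp + Ks) * (1 + 1 / R)"
  have K: "K > 0" unfolding K_def using Kp(1) Ks(1) assms(3) by (intro mult_pos_pos add_pos_pos) auto
  have term_bound: "(norm x)\<^sup>2 \<le> 8 * K\<^sup>2 * (of_int N)\<^sup>2 * ((norm a)\<^sup>2 + (norm b)\<^sup>2)"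
    if "norm x \<le> K * (2 * of_int N) * (norm a + norm b)" for x a b :: complex and N
  proof -
    have "(norm x)\<^sup>2 \<le> (K * (2 * of_int N) * (norm a + norm b))\<^sup>2" using that by (intro power_mono) auto
    also have "\<dots> = 4 * K\<^sup>2 * (of_int N)\<^sup>2 * (norm a + norm b)\<^sup>2" by (simp add: power_mult_distrib)
    also have "\<dots> \<le> 4 * K\<^sup>2 * (of_int N)\<^sup>2 * (2 * ((norm a)\<^sup>2 + (norm b)\<^sup>2))"
    proof (rule mult_left_mono)
      have "0 \<le> (norm a - norm b)\<^sup>2" by simp
      then show "(norm a + norm b)\<^sup>2 \<le> 2 * ((norm a)\<^sup>2 + (norm b)\<^sup>2)"
        by (simp add: power2_sum power2_diff)
    qed simp
    finally show ?thesis by (simp add: algebra_simps)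
  qed
  have al: "norm (alpha k_p R n R) \<le> K * (2 * of_int N)" "norm (alpha k_s R n R) \<le> K * (2 * of_int N)"
    and be: "norm (\<i> * of_int n / of_real R * beta k_p R n R) \<le> K * (2 * of_int N)"
      "norm (\<i> * of_int n / of_real R * beta k_s R n R) \<le> K * (2 * of_int N)"
    if "n \<in> {-N..N}" "N \<ge> 1" for n N
  proof -
    have n: "real (nat \<bar>n\<bar>) + 1 \<le> 2 * of_int N" "\<bar>of_int n\<bar> \<le> 2 * real_of_int N" "real_of_int N \<ge> 1" using that by auto
    have c: "Kp \<le> K" "Ks \<le> K" "Kp / R \<le> K" "Ks / R \<le> K"
      using Kp(1) Ks(1) assms(3) by (auto simp: K_def algebra_simps add_divide_distrib intro!: add_increasing add_increasing2)
    show "norm (alpha k_p R n R) \<le> K * (2 * of_int N)"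
      using n c K by (intro order.trans[OF Kp(3)] mult_mono) auto
    show "norm (alpha k_s R n R) \<le> K * (2 * of_int N)"
      using n c K by (intro order.trans[OF Ks(3)] mult_mono) auto
    have "norm (\<i> * of_int n / of_real R * beta k_p R n R) = norm (beta k_p R n R) / R * \<bar>of_int n\<bar>"
      using assms(3) by (simp add: norm_mult norm_divide)
    also have "\<dots> \<le> K * (2 * of_int N)"
      using n c K assms(3) Kp(1) Kp(2)[of n] by (intro mult_mono order.trans[OF _ c(3)] divide_right_mono) auto
    finally show "norm (\<i> * of_int n / of_real R * beta k_p R n R) \<le> K * (2 * of_int N)" .
    have "norm (\<i> * of_int n / of_real R * beta k_s R n R) = norm (beta k_s R n R) / R * \<bar>of_int n\<bar>"
      using assms(3) by (simp add: norm_mult norm_divide)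
    also have "\<dots> \<le> K * (2 * of_int N)"
      using n c K assms(3) Ks(1) Ks(2)[of n] by (intro mult_mono order.trans[OF _ c(4)] divide_right_mono) auto
    finally show "norm (\<i> * of_int n / of_real R * beta k_s R n R) \<le> K * (2 * of_int N)" .
  qed
  have lin: "norm (x * a + y * b) \<le> c * (norm a + norm b)" "norm (x * a - y * b) \<le> c * (norm a + norm b)"
    if "norm x \<le> c" "norm y \<le> c" for x y a b :: complex and c
  proof -
    have "norm (x * a) + norm (y * b) \<le> c * (norm a + norm b)"
      using that by (auto simp: norm_mult distrib_left intro!: add_mono mult_right_mono)
    then show "norm (x * a + y * b) \<le> c * (norm a + norm b)" "norm (x * a - y * b) \<le> c * (norm a + norm b)"
      using norm_triangle_ineq[of "x * a" "y * b"] norm_triangle_ineq4[of "x * a" "y * b"] by linarith+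
  qed
  have L: "?L \<ge> 0" using bessel_inequality[OF L2(1), of "{}"] bessel_inequality[OF L2(2), of "{}"] by simp
  show ?thesis
  proof (rule that[of "16 * K\<^sup>2 * ?L + 1"])
    show "16 * K\<^sup>2 * ?L + 1 > 0" using L by (intro add_nonneg_pos) auto
    fix N :: int assume N: "N \<ge> 1"
    let ?I = "{-N..N}"
    have "integral {0..2*pi} (\<lambda>\<theta>. (norm (field_trunc k_p k_s R ?a ?b N R \<theta>))\<^sup>2)
      = 2 * pi * (\<Sum>n\<in>?I. (norm (alpha k_p R n R * ?a n + \<i> * of_int n / of_real R * beta k_s R n R * ?b n))\<^sup>2
                 + (norm (\<i> * of_int n / of_real R * beta k_p R n R * ?a n - alpha k_s R n R * ?b n))\<^sup>2)"
      by (rule integral_unique[OF field_trunc_norm_square_has_integral])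
    also have "\<dots> \<le> 2 * pi * (\<Sum>n\<in>?I. 8 * K\<^sup>2 * (of_int N)\<^sup>2 * ((norm (?a n))\<^sup>2 + (norm (?b n))\<^sup>2)
                  + 8 * K\<^sup>2 * (of_int N)\<^sup>2 * ((norm (?a n))\<^sup>2 + (norm (?b n))\<^sup>2))"
      using N by (intro mult_left_mono sum_mono add_mono term_bound lin al be) auto
    also have "\<dots> = 16 * K\<^sup>2 * (of_int N)\<^sup>2 * (2 * pi * (\<Sum>n\<in>?I. (norm (?a n))\<^sup>2) + 2 * pi * (\<Sum>n\<in>?I. (norm (?b n))\<^sup>2))"
      by (simp add: sum_distrib_left[symmetric] sum.distrib algebra_simps)
    also have "\<dots> \<le> 16 * K\<^sup>2 * (of_int N)\<^sup>2 * ?L"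
      by (intro mult_left_mono add_mono bessel_inequality L2) auto
    also have "\<dots> \<le> (16 * K\<^sup>2 * ?L + 1) * (of_int N)\<^sup>2" by (simp add: algebra_simps)
    finally show "integral {0..2*pi} (\<lambda>\<theta>. (norm (field_trunc k_p k_s R ?a ?b N R \<theta>))\<^sup>2)
       \<le> (16 * K\<^sup>2 * ?L + 1) * (of_int N)\<^sup>2" .
  qed
qed

lemma fourier_coeff_bounded:
  assumes "L2_circle f"
  obtains A where "\<And>n. norm (fourier_coeff f n) \<le> A"
proof
  fix n
  have "2 * pi * (norm (fourier_coeff f n))\<^sup>2 \<le> (LINT \<theta>:{0..2*pi}|lebesgue. (norm (f \<theta>))\<^sup>2)"
    using bessel_inequality[OF assms, of "{n}"] by simp
  then have "(norm (fourier_coeff f n))\<^sup>2 \<le> (LINT \<theta>:{0..2*pi}|lebesgue. (norm (f \<theta>))\<^sup>2) / (2 * pi)"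
    by (simp add: field_simps)
  then show "norm (fourier_coeff f n) \<le> sqrt ((LINT \<theta>:{0..2*pi}|lebesgue. (norm (f \<theta>))\<^sup>2) / (2 * pi))"
    by (rule real_le_rsqrt)
qed

theorem theorem1:
  fixes D :: "(real^2) set" and \<rho> R lam mu om \<tau> :: real
    and z p :: "real^2"
    and v :: "real^2 \<Rightarrow> complex^2"
    and \<phi>p \<phi>s :: "real^2 \<Rightarrow> complex"
  assumes "open D" "connected D" "D \<noteq> {}" "bounded D" "simply_connected D" "C2_boundary D"
    and "\<rho> > 0" "D \<subseteq> ball 0 \<rho>" "connected (ball 0 \<rho> - closure D)"
    and "mu > 0" "lam + mu > 0" "om > 0"
    and "z \<in> sphere 0 \<rho>" "norm p = 1"
    and "C2_on (- closure D) v" "continuous_on (- D) v"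
    and "\<And>x. x \<in> - closure D \<Longrightarrow> lame_op lam mu v x + om\<^sup>2 *\<^sub>R v x = 0"
    and "\<And>x. x \<in> frontier D \<Longrightarrow> incident_field lam mu om z p x + v x = 0"
    and "kupradze_sommerfeld (kp lam mu om) (ks mu om) v"
    and "C2_on (- closure D) \<phi>p" "C2_on (- closure D) \<phi>s"
    and "\<And>x. x \<in> - closure D \<Longrightarrow> laplacian \<phi>p x + of_real ((kp lam mu om)\<^sup>2) * \<phi>p x = 0"
    and "\<And>x. x \<in> - closure D \<Longrightarrow> laplacian \<phi>s x + of_real ((ks mu om)\<^sup>2) * \<phi>s x = 0"
    and "sommerfeld (kp lam mu om) \<phi>p" "sommerfeld (ks mu om) \<phi>s"
    and "\<And>x. x \<in> - closure D \<Longrightarrow> v x = grad \<phi>p x + vcurl \<phi>s x"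
    and "R > 0" "ball 0 R \<subseteq> D"
    and "L2_circle (\<lambda>\<theta>. \<phi>p (polar R \<theta>))" "L2_circle (\<lambda>\<theta>. \<phi>s (polar R \<theta>))"
    and "\<And>r \<theta>. r > R \<Longrightarrow>
      ((\<lambda>n. beta (kp lam mu om) R n r * fourier_coeff (\<lambda>\<theta>. \<phi>p (polar R \<theta>)) n * cis (of_int n * \<theta>))
        has_sum \<phi>p (polar r \<theta>)) UNIV"
    and "\<And>r \<theta>. r > R \<Longrightarrow>
      ((\<lambda>n. beta (ks mu om) R n r * fourier_coeff (\<lambda>\<theta>. \<phi>s (polar R \<theta>)) n * cis (of_int n * \<theta>))
        has_sum \<phi>s (polar r \<theta>)) UNIV"
    and "\<tau> = \<rho> / R"
  shows "\<exists>C1 C2 :: real. C1 > 0 \<and> C2 > 0 \<and>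
    (\<forall>N::int. of_int N \<ge> 4 * ks mu om * \<rho> + 1 \<longrightarrow>
      (let w = (\<lambda>\<theta>. v (polar \<rho> \<theta>)
              - field_trunc (kp lam mu om) (ks mu om) R
                  (fourier_coeff (\<lambda>\<theta>. \<phi>p (polar R \<theta>)))
                  (fourier_coeff (\<lambda>\<theta>. \<phi>s (polar R \<theta>))) N \<rho> \<theta>)
       in L2_circle w \<and>
          (L2_circle_norm \<rho> w)\<^sup>2
            \<le> C1 * \<tau> powi (-2 * N) + C2 * (of_int N)\<^sup>2 * \<tau> powi (4 - 2 * N)))"
proof -
  define k_p where "k_p = kp lam mu om"
  define k_s where "k_s = ks mu om"
  define a where "a = fourier_coeff (\<lambda>\<theta>. \<phi>p (polar R \<theta>))"
  define b where "b = fourier_coeff (\<lambda>\<theta>. \<phi>s (polar R \<theta>))"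
  define w where "w = (\<lambda>N \<theta>. v (polar \<rho> \<theta>) - field_trunc k_p k_s R a b N \<rho> \<theta>)"
  have k: "k_p > 0" "k_s > 0"
    using assms(10-12) by (auto simp: k_p_def k_s_def kp_def ks_def)
  have R\<rho>: "R \<le> \<rho>"
  proof -
    have "ball (0::real^2) R \<subseteq> ball 0 \<rho>" using assms(8,28) by blast
    then show ?thesis using assms(27) by (simp add: ball_subset_ball_iff)
  qed
  have cont_v: "continuous_on (- ball 0 \<rho>) v"
    by (rule continuous_on_subset[OF assms(16)]) (use assms(8) in blast)
  have cont_vc: "continuous_on {0..2*pi} (\<lambda>\<theta>. v (polar \<rho> \<theta>))"
    by (rule continuous_on_compose2[OF cont_v continuous_on_polar]) (use assms(7) in auto)
  have cont_w: "continuous_on {0..2*pi} (w N)" for N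
    unfolding w_def by (intro continuous_on_diff cont_vc continuous_on_field_trunc)
  have L2: "L2_circle (w N)" "(L2_circle_norm \<rho> (w N))\<^sup>2 = \<rho> * integral {0..2*pi} (\<lambda>\<theta>. (norm (w N \<theta>))\<^sup>2)" for N
    using L2_circle_continuous[OF cont_w] L2_circle_norm_square[OF cont_w] assms(7) by auto
  have int_w: "(\<lambda>\<theta>. (norm (w N \<theta>))\<^sup>2) integrable_on {0..2*pi}" for N
    by (intro integrable_continuous_interval continuous_intros cont_w)
  have \<tau>: "\<tau> \<ge> 1" using R\<rho> assms(7,27,33) by simp
  (* One constant for both terms; in the case R < \<rho> the first term only enlarges the bound. *)
  have "\<exists>C>0. \<forall>N::nat. N \<ge> 1 \<longrightarrow> \<rho> * integral {0..2*pi} (\<lambda>\<theta>. (norm (w (int N) \<theta>))\<^sup>2)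
      \<le> C * ((1 / \<tau>) ^ N)\<^sup>2 + C * ((real N)\<^sup>2 * ((1 / \<tau>) ^ N)\<^sup>2)"
  proof (cases "R = \<rho>")
    case True
    (* Here \<tau> = 1, so a bound by a constant plus a multiple of N^2 suffices. *)
    define V where "V = integral {0..2*pi} (\<lambda>\<theta>. (norm (v (polar \<rho> \<theta>)))\<^sup>2)"
    obtain C where C: "C > 0" "\<And>N. N \<ge> 1 \<Longrightarrow> integral {0..2*pi} (\<lambda>\<theta>. (norm (field_trunc k_p k_s R a b N R \<theta>))\<^sup>2) \<le> C * (of_int N)\<^sup>2"
      using field_trunc_norm_at_R[OF k assms(27,29,30)] unfolding a_def b_def by blast
    have V: "V \<ge> 0" unfolding V_def
      by (intro integral_nonneg integrable_continuous_interval continuous_intros cont_vc) auto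
    define K where "K = \<rho> * (2 * V + 2 * C)"
    have K: "K > 0" unfolding K_def using V C(1) assms(7) by (intro mult_pos_pos add_nonneg_pos) auto
    have "\<rho> * integral {0..2*pi} (\<lambda>\<theta>. (norm (w (int N) \<theta>))\<^sup>2) \<le> K + K * (real N)\<^sup>2" if N: "N \<ge> 1" for N :: nat
    proof -
      let ?F = "field_trunc k_p k_s R a b (int N) R"
      have iv: "(\<lambda>\<theta>. (norm (v (polar \<rho> \<theta>)))\<^sup>2) integrable_on {0..2*pi}"
        by (intro integrable_continuous_interval continuous_intros cont_vc)
      have iF: "(\<lambda>\<theta>. (norm (?F \<theta>))\<^sup>2) integrable_on {0..2*pi}"
        by (intro integrable_continuous_interval continuous_intros continuous_on_field_trunc)
      have "integral {0..2*pi} (\<lambda>\<theta>. (norm (w (int N) \<theta>))\<^sup>2)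
          \<le> integral {0..2*pi} (\<lambda>\<theta>. 2 * (norm (v (polar \<rho> \<theta>)))\<^sup>2 + 2 * (norm (?F \<theta>))\<^sup>2)"
      proof (rule integral_le[OF int_w])
        show "(\<lambda>\<theta>. 2 * (norm (v (polar \<rho> \<theta>)))\<^sup>2 + 2 * (norm (?F \<theta>))\<^sup>2) integrable_on {0..2*pi}"
          by (intro integrable_add integrable_on_mult_right iv iF)
        fix \<theta>
        have "(norm (x - y))\<^sup>2 \<le> 2 * (norm x)\<^sup>2 + 2 * (norm y)\<^sup>2" for x y :: "complex^2"
        proof -
          have "(norm (x - y))\<^sup>2 \<le> (norm x + norm y)\<^sup>2"
            by (intro power_mono norm_triangle_ineq4) auto
          also have "0 \<le> (norm x - norm y)\<^sup>2" by simp
          then have "(norm x + norm y)\<^sup>2 \<le> 2 * (norm x)\<^sup>2 + 2 * (norm y)\<^sup>2"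
            by (simp add: power2_sum power2_diff)
          finally show ?thesis .
        qed
        then show "(norm (w (int N) \<theta>))\<^sup>2 \<le> 2 * (norm (v (polar \<rho> \<theta>)))\<^sup>2 + 2 * (norm (?F \<theta>))\<^sup>2"
          by (simp add: w_def True)
      qed
      also have "\<dots> = 2 * V + 2 * integral {0..2*pi} (\<lambda>\<theta>. (norm (?F \<theta>))\<^sup>2)"
        unfolding V_def by (simp add: integral_add integrable_on_mult_right iv iF)
      also have "\<dots> \<le> 2 * V + 2 * (C * (real N)\<^sup>2)"
        using C(2)[of "int N"] N by simp
      also have "\<dots> \<le> (2 * V + 2 * C) + (2 * V + 2 * C) * (real N)\<^sup>2"
        using V C(1) by (simp add: algebra_simps)
      finally have "\<rho> * integral {0..2*pi} (\<lambda>\<theta>. (norm (w (int N) \<theta>))\<^sup>2) \<le> \<rho> * ((2 * V + 2 * C) + (2 * V + 2 * C) * (real N)\<^sup>2)"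
        using assms(7) by (intro mult_left_mono) auto
      then show ?thesis by (simp add: K_def algebra_simps)
    qed
    then show ?thesis using K assms(7,33) True by (intro exI[of _ K]) auto
  next
    case False
    then have less: "R < \<rho>" using R\<rho> by simp
    obtain A1 where A1: "\<And>n. norm (a n) \<le> A1" using fourier_coeff_bounded[OF assms(29)] unfolding a_def by blast
    obtain A2 where A2: "\<And>n. norm (b n) \<le> A2" using fourier_coeff_bounded[OF assms(30)] unfolding b_def by blast
    (* The domain lies in the open disc of radius \<rho>, but its closure may reach the circle;
       strictly outside the circle the potentials represent v. *)
    have exterior: "polar r \<theta> \<in> - closure D" if "r > \<rho>" for r \<theta>
    proof -
      have "closure D \<subseteq> cball 0 \<rho>"
        using closure_mono[OF assms(8)] assms(7) by (simp add: closure_ball)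
      then show ?thesis using that assms(7) by auto
    qed
    obtain C where C: "C > 0" "\<And>r \<theta> N. \<rho> < r \<Longrightarrow> r < \<rho> + 1 \<Longrightarrow> N \<ge> 1 \<Longrightarrow>
      norm (grad \<phi>p (polar r \<theta>) + vcurl \<phi>s (polar r \<theta>) - field_trunc k_p k_s R a b (int N) r \<theta>)
        \<le> C * real N * (R / \<rho>) ^ N"
    proof (rule exterior_field_truncation_error[of k_p k_s R \<rho> a "max A1 A2" b \<phi>p \<phi>s])
      show "norm (a n) \<le> max A1 A2" "norm (b n) \<le> max A1 A2" for n using A1[of n] A2[of n] by auto
      show "\<phi>p differentiable at (polar r \<theta>)" "\<phi>s differentiable at (polar r \<theta>)" if "r > \<rho>" for r \<theta>
        using assms(20,21) exterior[OF that, of \<theta>] unfolding C2_on_def by blast+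
    qed (use k less assms(27) assms(31,32)[folded k_p_def k_s_def a_def b_def] in auto)
    have pointwise: "norm (w (int N) \<theta>) \<le> C * real N * (R / \<rho>) ^ N" if N: "N \<ge> 1" for N \<theta>
      unfolding w_def
    proof (rule boundary_truncation_error[OF k assms(27,7) cont_v])
      fix r assume r: "\<rho> < r" "r < \<rho> + 1"
      show "norm (v (polar r \<theta>) - field_trunc k_p k_s R a b (int N) r \<theta>) \<le> C * real N * (R / \<rho>) ^ N"
        unfolding assms(26)[OF exterior[OF r(1)]] by (rule C(2)[OF r N])
    qed
    define K where "K = \<rho> * (2 * pi * C\<^sup>2)"
    have K: "K > 0" unfolding K_def using C(1) assms(7) by simp
    have "\<rho> * integral {0..2*pi} (\<lambda>\<theta>. (norm (w (int N) \<theta>))\<^sup>2) \<le> K * ((real N)\<^sup>2 * ((1 / \<tau>) ^ N)\<^sup>2)"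
      if N: "N \<ge> 1" for N
    proof -
      have "integral {0..2*pi} (\<lambda>\<theta>. (norm (w (int N) \<theta>))\<^sup>2) \<le> integral {0..2*pi} (\<lambda>\<theta>. (C * real N * (R / \<rho>) ^ N)\<^sup>2)"
        by (rule integral_le[OF int_w]) (auto intro: power_mono pointwise[OF N])
      also have "\<dots> = 2 * pi * C\<^sup>2 * ((real N)\<^sup>2 * ((1 / \<tau>) ^ N)\<^sup>2)"
        by (simp add: assms(33) power_mult_distrib)
      finally have "\<rho> * integral {0..2*pi} (\<lambda>\<theta>. (norm (w (int N) \<theta>))\<^sup>2) \<le> \<rho> * (2 * pi * C\<^sup>2 * ((real N)\<^sup>2 * ((1 / \<tau>) ^ N)\<^sup>2))"
        using assms(7) by (intro mult_left_mono) auto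
      then show ?thesis by (simp only: K_def mult.assoc)
    qed
    moreover have "K * ((1 / \<tau>) ^ N)\<^sup>2 \<ge> 0" for N using K by simp
    ultimately show ?thesis using K by (intro exI[of _ K]) (auto intro: add_increasing)
  qed
  then obtain C where C: "C > 0" "\<And>N::nat. N \<ge> 1 \<Longrightarrow> \<rho> * integral {0..2*pi} (\<lambda>\<theta>. (norm (w (int N) \<theta>))\<^sup>2)
      \<le> C * ((1 / \<tau>) ^ N)\<^sup>2 + C * ((real N)\<^sup>2 * ((1 / \<tau>) ^ N)\<^sup>2)"
    by blast
  have "(L2_circle_norm \<rho> (w N))\<^sup>2 \<le> C * \<tau> powi (-2 * N) + C * (of_int N)\<^sup>2 * \<tau> powi (4 - 2 * N)"
    if N: "of_int N \<ge> 4 * ks mu om * \<rho> + 1" for N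
  proof -
    have "4 * ks mu om * \<rho> > 0" using k(2) assms(7) by (simp add: k_s_def)
    then have "N \<ge> 1" using N by linarith
    then obtain M :: nat where M: "N = int M" "M \<ge> 1" by (metis int_one_le_iff_zero_less nat_0_le zero_less_imp_eq_int Suc_leI One_nat_def of_nat_0_less_iff)
    have e: "((1 / \<tau>) ^ M)\<^sup>2 = \<tau> powi (-2 * N)"
    proof -
      have "\<tau> powi (-2 * N) = inverse (\<tau> powi (int (2 * M)))"
        by (simp add: M(1) flip: power_int_minus)
      also have "\<dots> = ((1 / \<tau>) ^ M)\<^sup>2"
        unfolding power_int_of_nat by (simp add: power_divide divide_inverse power_mult power2_eq_square power_mult_distrib power_inverse)
      finally show ?thesis by simp
    qed
    have "\<tau> powi (-2 * N) \<le> \<tau> powi (4 - 2 * N)"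
      using \<tau> by (intro power_int_increasing) auto
    then have "C * ((of_int N)\<^sup>2 * \<tau> powi (-2 * N)) \<le> C * ((of_int N)\<^sup>2 * \<tau> powi (4 - 2 * N))"
      using C(1) by (intro mult_left_mono) auto
    then show ?thesis
      using C(2)[OF M(2)] unfolding L2(2) e by (simp add: M(1) mult.assoc)
  qed
  then have "\<forall>N::int. of_int N \<ge> 4 * ks mu om * \<rho> + 1 \<longrightarrow> (let w = w N in L2_circle w \<and>
      (L2_circle_norm \<rho> w)\<^sup>2 \<le> C * \<tau> powi (-2 * N) + C * (of_int N)\<^sup>2 * \<tau> powi (4 - 2 * N))"
    unfolding Let_def using L2(1) by blast
  then show ?thesis
    unfolding w_def k_p_def k_s_def a_def b_def using C(1) by blast
qed

end
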